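(* Let $A\in\mathbb{R}^{n\times n}$, $B\in\mathbb{R}^{n\times m}$, $Q\in\mathcal{S}^n_+$, $R\in\mathcal{S}^m_{++}$, with $(A,B)$ stabilizable and $(A,\sqrt Q)$ detectable, let $W=Q\oplus R$, and let $\mu_0\in\mathbb{R}^n$, $\Sigma_0\succ0$, $\Sigma\succeq0$, $X_0=\Sigma_0+\mu_0\mu_0^\top$. Then for every $r\in(0,1)$ sufficiently close to $1$ (i.e. for all $r\in(r_0,1)$ for some $r_0<1$ depending on the data) the following holds. Let $(F^*,M^* )$ denote the optimal point of the convex problem, in the variables $M\in\mathbb{R}^{n\times n}$ and $F=\begin{bmatrix} F_{11} & F_{12} \\ F_{12}^\top & F_{22} \end{bmatrix}\in\mathcal{S}^{n+m}$ (with $F_{11}\in\mathcal{S}^n$, $F_{22}\in\mathcal{S}^m$, $F_{12}\in\mathbb{R}^{n\times m}$), $$\max_{F,M}\ \operatorname{tr}\Big(\big(X_0+\tfrac{r}{1-r}\Sigma\big)M\Big)$$ $$\text{s.t.}\quad r\begin{bmatrix}A&B\end{bmatrix}^\top\big(F_{11}-F_{12}F_{22}^{-1}F_{12}^\top\big)\begin{bmatrix}A&B\end{bmatrix}-F+W\succeq0,\qquad F_{22}\succ0,\qquad F_{11}-F_{12}F_{22}^{-1}F_{12}^\top-M\succeq0.$$ Then $(F^*,M^* )$ is independent of $X_0+\frac{r}{1-r}\Sigma$. Furthermore, $F^*=H^*$ and $M^*=P^*$, where $P^*$ is the unique positive semidefinite solution of the discrete-time algebraic Riccati equation $$P=Q+rA^\top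 PA-r^2A^\top PB\,(R+rB^\top PB)^{-1}B^\top PA,$$ and $H^*$ is the parameter matrix of the optimal Q-function, $$H^*=\begin{bmatrix} Q+rA^\top P^*A & rA^\top P^*B \\ rB^\top P^*A & R+rB^\top P^*B \end{bmatrix}.$$
   Context: $\mathcal{S}^l,\mathcal{S}^l_+,\mathcal{S}^l_{++}$ denote the symmetric, symmetric positive semidefinite, and symmetric positive definite $l\times l$ real matrices; $M\succeq0$ (resp. $M\succ0$) means $M\in\mathcal{S}^l_+$ (resp. $\mathcal{S}^l_{++}$), so in particular $\succeq$ entails symmetry. $M_1\oplus M_2$ is the block-diagonal matrix with blocks $M_1,M_2$. Background for the names: the data come from the system $x_{k+1}=Ax_k+Bu_k+w_k$ with $x_0\sim\mathcal{N}(\mu_0,\Sigma_0)$, i.i.d. $w_k\sim\mathcal{N}(0,\Sigma)$ independent of $x_0$, and discounted cost $\sum_k r^k\mathbb{E}(x_k^\top Qx_k+u_k^\top Ru_k)$. The optimal Q-function is $Q^*(x_k,u_k)=\mathbb{E}\big([x_k^\top,u_k^\top]H^*[x_k^\top,u_k^\top]^\top\big)+\frac{r}{1-r}\operatorname{tr}(P^*\Sigma)$ with $H^*$ as displayed in the claim, and the optimal gain is $L^*=-(R+rB^\top P^*B)^{-1}rB^\top P^*A$.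
   Formalization: The optimal F is never unique (A=B=0, n=m=1: F=diag(q,f), 0<f≤1, M=q are all optimal). So F*=H* is replaced by: (H*,P* ) is optimal, and every optimal (F,M) has M=P*, H*−F⪰0 and −F22^{-1}F12^T=L*; the optimal set does not depend on the weight. *)

theory Defs
  imports "HOL-Analysis.Analysis"
begin

definition psd :: "real^'n^'n \<Rightarrow> bool" where
  "psd M \<longleftrightarrow> transpose M = M \<and> (\<forall>x. 0 \<le> x \<bullet> (M *v x))"

definition pd :: "real^'n^'n \<Rightarrow> bool" where
  "pd M \<longleftrightarrow> transpose M = M \<and> (\<forall>x. x \<noteq> 0 \<longrightarrow> 0 < x \<bullet> (M *v x))"

text \<open>Every positive semidefinite matrix has exactly one positive semidefinite square root,
  so the description below is well defined whenever \<open>psd Q\<close>.\<close>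
definition psd_sqrt :: "real^'n^'n \<Rightarrow> real^'n^'n" where
  "psd_sqrt Q = (THE S. psd S \<and> S ** S = Q)"

text \<open>All complex eigenvalues lie in the open unit disc.\<close>
definition schur_stable :: "real^'n^'n \<Rightarrow> bool" where
  "schur_stable M \<longleftrightarrow>
     (\<forall>(z::complex) (v::complex^'n).
        v \<noteq> 0 \<and> (\<chi> i j. complex_of_real (M $ i $ j)) *v v = z *s v \<longrightarrow> cmod z < 1)"

definition stabilizable :: "real^'n^'n \<Rightarrow> real^'m^'n \<Rightarrow> bool" where
  "stabilizable A B \<longleftrightarrow> (\<exists>K::real^'n^'m. schur_stable (A + B ** K))"

definition detectable :: "real^'n^'n \<Rightarrow> real^'n^'p \<Rightarrow> bool" where
  "detectable A C \<longleftrightarrow> (\<exists>G::real^'p^'n. schur_stable (A + G ** C))"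

text \<open>Matrices of size \<open>n + m\<close> are indexed by the sum type, \<open>Inl\<close> addressing the
  first \<open>n\<close> and \<open>Inr\<close> the last \<open>m\<close> coordinates.\<close>

definition block_matrix ::
  "real^'n^'n \<Rightarrow> real^'m^'n \<Rightarrow> real^'n^'m \<Rightarrow> real^'m^'m \<Rightarrow> real^('n::finite + 'm::finite)^('n::finite + 'm::finite)" where
  "block_matrix M11 M12 M21 M22 =
     (\<chi> i j. case i of
         Inl a \<Rightarrow> (case j of Inl b \<Rightarrow> M11 $ a $ b | Inr b \<Rightarrow> M12 $ a $ b)
       | Inr a \<Rightarrow> (case j of Inl b \<Rightarrow> M21 $ a $ b | Inr b \<Rightarrow> M22 $ a $ b))"

definition row_blocks :: "real^'n^'n \<Rightarrow> real^'m^'n \<Rightarrow> real^('n::finite + 'm::finite)^'n" where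
  "row_blocks A B = (\<chi> i j. case j of Inl b \<Rightarrow> A $ i $ b | Inr b \<Rightarrow> B $ i $ b)"

definition block11 :: "real^('n::finite + 'm::finite)^('n::finite + 'm::finite) \<Rightarrow> real^'n^'n" where
  "block11 F = (\<chi> i j. F $ Inl i $ Inl j)"

definition block12 :: "real^('n::finite + 'm::finite)^('n::finite + 'm::finite) \<Rightarrow> real^'m^'n" where
  "block12 F = (\<chi> i j. F $ Inl i $ Inr j)"

definition block22 :: "real^('n::finite + 'm::finite)^('n::finite + 'm::finite) \<Rightarrow> real^'m^'m" where
  "block22 F = (\<chi> i j. F $ Inr i $ Inr j)"

text \<open>Meant for symmetric \<open>F\<close> only: the lower left block is the transpose of the
  upper right one.\<close>
definition schur_complement :: "real^('n::finite + 'm::finite)^('n::finite + 'm::finite) \<Rightarrow> real^'n^'n" where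
  "schur_complement F =
     block11 F - block12 F ** matrix_inv (block22 F) ** transpose (block12 F)"

definition outer :: "real^'n \<Rightarrow> real^'n^'n" where
  "outer v = (\<chi> i j. v $ i * v $ j)"

definition feasible ::
  "real \<Rightarrow> real^'n^'n \<Rightarrow> real^'m^'n \<Rightarrow> real^'n^'n \<Rightarrow> real^'m^'m \<Rightarrow>
   (real^('n::finite + 'm::finite)^('n::finite + 'm::finite)) \<times> (real^'n^'n) \<Rightarrow> bool" where
  "feasible r A B Q R = (\<lambda>(F, M).
     transpose F = F \<and>
     psd (r *\<^sub>R (transpose (row_blocks A B) ** schur_complement F ** row_blocks A B)
          - F + block_matrix Q 0 0 R) \<and>
     pd (block22 F) \<and>
     psd (schur_complement F - M))"

text \<open>Maximisers of \<open>tr (V M)\<close> over the feasible set. They are never unique in \<open>F\<close>: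
  keeping the Schur complement and the gain \<open>- F22\<inverse> F12\<^sup>T\<close> of an optimal \<open>F\<close> fixed,
  the block \<open>F22\<close> can be decreased without losing feasibility.\<close>
definition optimal_points ::
  "real \<Rightarrow> real^'n^'n \<Rightarrow> real^'m^'n \<Rightarrow> real^'n^'n \<Rightarrow> real^'m^'m \<Rightarrow> real^'n^'n \<Rightarrow>
   ((real^('n::finite + 'm::finite)^('n::finite + 'm::finite)) \<times> (real^'n^'n)) set" where
  "optimal_points r A B Q R V =
     {(F, M). feasible r A B Q R (F, M) \<and>
        (\<forall>F' M'. feasible r A B Q R (F', M') \<longrightarrow> trace (V ** M') \<le> trace (V ** M))}"

definition second_moment :: "real \<Rightarrow> real^'n \<Rightarrow> real^'n^'n \<Rightarrow> real^'n^'n \<Rightarrow> real^'n^'n" where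
  "second_moment r \<mu>0 \<Sigma>0 \<Sigma> = (\<Sigma>0 + outer \<mu>0) + (r / (1 - r)) *\<^sub>R \<Sigma>"

definition riccati_solution ::
  "real \<Rightarrow> real^'n^'n \<Rightarrow> real^'m^'n \<Rightarrow> real^'n^'n \<Rightarrow> real^'m^'m \<Rightarrow> real^'n^'n \<Rightarrow> bool" where
  "riccati_solution r A B Q R P \<longleftrightarrow>
     P = Q + r *\<^sub>R (transpose A ** P ** A)
         - r\<^sup>2 *\<^sub>R (transpose A ** P ** B ** matrix_inv (R + r *\<^sub>R (transpose B ** P ** B))
                    ** transpose B ** P ** A)"

definition q_matrix ::
  "real \<Rightarrow> real^'n^'n \<Rightarrow> real^'m^'n \<Rightarrow> real^'n^'n \<Rightarrow> real^'m^'m \<Rightarrow> real^'n^'n \<Rightarrow>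
   real^('n::finite + 'm::finite)^('n::finite + 'm::finite)" where
  "q_matrix r A B Q R P =
     block_matrix (Q + r *\<^sub>R (transpose A ** P ** A)) (r *\<^sub>R (transpose A ** P ** B))
                  (r *\<^sub>R (transpose B ** P ** A)) (R + r *\<^sub>R (transpose B ** P ** B))"

definition optimal_gain ::
  "real \<Rightarrow> real^'n^'n \<Rightarrow> real^'m^'n \<Rightarrow> real^'m^'m \<Rightarrow> real^'n^'n \<Rightarrow> real^'n^'m" where
  "optimal_gain r A B R P =
     - (matrix_inv (R + r *\<^sub>R (transpose B ** P ** B)) ** (r *\<^sub>R (transpose B ** P ** A)))"

end

theory Submission
  imports Defs "HOL-Computational_Algebra.Fundamental_Theorem_Algebra"
begin

text \<open>Completing the square turns the constraint on \<open>F\<close> into the Bellman inequality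
  \<open>[x; u]\<^sup>T F [x; u] \<le> x\<^sup>T Q x + u\<^sup>T R u + r (A x + B u)\<^sup>T S (A x + B u)\<close> with \<open>S\<close> the Schur
  complement of \<open>F\<close>. At the input of the optimal gain \<open>L\<close>, \<open>u = L x\<close>, it gives
  \<open>P* - S \<succeq> T\<^sup>T (P* - S) T\<close> for the closed loop \<open>T = \<surd>r (A + B L)\<close>. By detectability \<open>T\<close> is
  Schur stable, so iterating yields \<open>M \<preceq> S \<preceq> P*\<close> for every feasible point; the same argument gives
  uniqueness for the Riccati equation. As the weight is positive definite, an optimal point has
  \<open>M = S = P*\<close> whatever the weight, and comparing the squares at \<open>u = L x\<close> determines the gain.\<close>

subsection \<open>Symmetric matrices\<close>

lemma transpose_matrix_add: "transpose (M + N) = transpose M + transpose N"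
  by (simp add: transpose_def vec_eq_iff)

lemma transpose_matrix_diff: "transpose (M - N :: real^'n^'m) = transpose M - transpose N"
  by (simp add: transpose_def vec_eq_iff)

lemma uminus_matrix_vector_mult: "(- M) *v x = - (M *v x)" for M :: "real^'n^'m"
  by (metis diff_0 matrix_vector_mult_0 matrix_vector_mult_diff_rdistrib)

lemma matrix_diff_ldistrib: "V ** (M - N) = V ** M - V ** N" for V :: "real^'n^'m"
  by (simp add: matrix_matrix_mult_def vec_eq_iff sum_subtractf right_diff_distrib)

lemma inner_transpose_mult:
  fixes A :: "real^'n^'m"
  shows "(transpose A *v x) \<bullet> y = x \<bullet> (A *v y)"
  by (simp add: dot_lmul_matrix)

lemma symmetric_inner_commute:
  fixes Q :: "real^'n^'n"
  assumes "transpose Q = Q"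
  shows "(Q *v x) \<bullet> y = x \<bullet> (Q *v y)"
  by (metis assms inner_transpose_mult)

lemma symmetric_eqI:
  fixes P S :: "real^'n^'n"
  assumes "transpose P = P" "transpose S = S" "\<And>x. x \<bullet> (P *v x) = x \<bullet> (S *v x)"
  shows "P = S"
proof -
  let ?D = "P - S"
  have tD: "transpose ?D = ?D" using assms(1,2) by (simp add: transpose_def vec_eq_iff)
  have z: "x \<bullet> (?D *v x) = 0" for x
    by (simp add: matrix_vector_mult_diff_rdistrib inner_diff_right assms(3))
  have "?D *v x = 0" for x
  proof -
    \<comment> \<open>The vanishing form, tested at \<open>x + ?D *v x\<close>, leaves only the two
      cross terms, and by symmetry each of them is the squared norm of
      \<open>?D *v x\<close>.\<close>
    let ?y = "?D *v x"
    have "0 = (x + ?y) \<bullet> (?D *v (x + ?y))" by (simp only: z)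
    also have "\<dots> = x \<bullet> (?D *v x) + x \<bullet> (?D *v ?y) + ?y \<bullet> (?D *v x) + ?y \<bullet> (?D *v ?y)"
      by (simp only: matrix_vector_right_distrib inner_add_left inner_add_right add.assoc)
    also have "x \<bullet> (?D *v ?y) = ?y \<bullet> ?y" by (metis symmetric_inner_commute[OF tD])
    finally have "?y \<bullet> ?y = 0" by (simp only: z)
    then show ?thesis by simp
  qed
  then have "?D = 0" by (metis matrix_eq matrix_vector_mult_0)
  then show ?thesis by simp
qed

lemma psd_antisym:
  assumes "psd (P - S)" "psd (S - P)" "transpose S = S"
  shows "P = S"
proof (rule symmetric_eqI)
  show "transpose P = P"
    using assms(1,3) by (simp add: psd_def transpose_def vec_eq_iff)
  fix x
  show "x \<bullet> (P *v x) = x \<bullet> (S *v x)"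
    using assms(1,2) unfolding psd_def
    by (metis (no_types, lifting) diff_ge_0_iff_ge inner_diff_right matrix_vector_mult_diff_rdistrib order_antisym)
qed fact

section \<open>The spectral theorem for symmetric matrices\<close>

lemma linear_coefficient_zero:
  fixes b h :: real
  assumes "\<And>t. 0 \<le> 2 * t * b + t\<^sup>2 * h"
  shows "b = 0"
proof (rule ccontr)
  assume "b \<noteq> 0"
  \<comment> \<open>With this \<open>s\<close>, the point \<open>t = - b / s\<close> is close enough
    to 0 for the linear term to dominate: the value there is \<open>b^2 / s\<close> times
    \<open>h / s - 2\<close>, and \<open>h / s < 1\<close>.\<close>
  define s where "s = 1 + \<bar>h\<bar>"
  have s: "s > 0" "h < s" by (auto simp: s_def)
  have "0 \<le> 2 * (- b / s) * b + (- b / s)\<^sup>2 * h" by (rule assms)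
  also have "\<dots> = (b\<^sup>2 / s) * (h / s - 2)"
    using s by (simp add: field_simps power2_eq_square)
  also have "\<dots> < 0"
    using s \<open>b \<noteq> 0\<close> by (intro mult_pos_neg) (auto simp: field_simps)
  finally show False by simp
qed

text \<open>A maximiser \<open>x\<close> of the Rayleigh quotient on the unit sphere of
  \<open>W\<close> is an eigenvector. Moving from \<open>x\<close> in the direction of the residual
  \<open>c *\<^sub>R x - Q *v x\<close>, which stays in \<open>W\<close> by invariance, changes the
  form with a first-order term proportional to the squared norm of the residual, so the residual
  vanishes.\<close>

lemma symmetric_eigenvector_in_subspace:
  fixes Q :: "real^'n^'n"
  assumes sym: "transpose Q = Q" and W: "subspace W" "W \<noteq> {0}"
    and inv: "\<And>x. x \<in> W \<Longrightarrow> Q *v x \<in> W"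
  obtains x c where "x \<in> W" "norm x = 1" "Q *v x = c *\<^sub>R x"
proof -
  let ?S = "sphere 0 1 \<inter> W"
  obtain y where y: "y \<in> W" "y \<noteq> 0" using W subspace_0 by blast
  then have "(1 / norm y) *\<^sub>R y \<in> ?S" using W by (auto intro: subspace_mul)
  then have "?S \<noteq> {}" by blast
  moreover have "compact ?S"
    by (intro compact_Int_closed) (auto simp: closed_subspace W)
  moreover have "continuous_on ?S (\<lambda>x. x \<bullet> (Q *v x))"
    by (intro continuous_intros)
  ultimately obtain x where x: "x \<in> ?S" and max: "\<And>y. y \<in> ?S \<Longrightarrow> y \<bullet> (Q *v y) \<le> x \<bullet> (Q *v x)"
    using continuous_attains_sup[of ?S "\<lambda>x. x \<bullet> (Q *v x)"] by blast
  define c where "c = x \<bullet> (Q *v x)"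
  have xx: "x \<bullet> x = 1" "x \<in> W" using x by (auto simp: norm_eq_1)
  have le: "w \<bullet> (Q *v w) \<le> c * (w \<bullet> w)" if "w \<in> W" for w
  proof (cases "w = 0")
    case False
    let ?u = "(1 / norm w) *\<^sub>R w"
    have "?u \<in> ?S" using False that W by (auto intro: subspace_mul)
    then have "?u \<bullet> (Q *v ?u) \<le> c" using max c_def by blast
    then have "(w \<bullet> (Q *v w)) / (norm w)\<^sup>2 \<le> c"
      by (simp add: matrix_vector_mult_scaleR power2_eq_square)
    then show ?thesis
      using False by (simp add: field_simps power2_norm_eq_inner)
  qed simp
  define y where "y = c *\<^sub>R x - Q *v x"
  have yW: "y \<in> W" unfolding y_def using xx W inv by (intro subspace_diff subspace_mul) auto
  have "0 \<le> 2 * t * (y \<bullet> y) + t\<^sup>2 * (c * (y \<bullet> y) - y \<bullet> (Q *v y))" for t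
  proof -
    have "x + t *\<^sub>R y \<in> W" using xx yW W by (intro subspace_add subspace_mul) auto
    from le[OF this]
    have "x \<bullet> (Q *v x) + t * (x \<bullet> (Q *v y)) + t * (y \<bullet> (Q *v x)) + t\<^sup>2 * (y \<bullet> (Q *v y))
       \<le> c * (x \<bullet> x) + 2 * t * c * (x \<bullet> y) + t\<^sup>2 * c * (y \<bullet> y)"
      by (simp add: matrix_vector_right_distrib matrix_vector_mult_scaleR inner_add_left inner_add_right
          algebra_simps power2_eq_square inner_commute)
    moreover have "x \<bullet> (Q *v y) = y \<bullet> (Q *v x)"
      by (metis symmetric_inner_commute[OF sym] inner_commute)
    moreover
    have "y \<bullet> y = c * (x \<bullet> y) - y \<bullet> (Q *v x)"
      by (subst (2) y_def) (simp add: inner_diff_right inner_commute)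
    then have "y \<bullet> (Q *v x) = c * (x \<bullet> y) - y \<bullet> y" by simp
    ultimately show ?thesis using xx unfolding c_def[symmetric] by (simp add: algebra_simps)
  qed
  then have "y \<bullet> y = 0" by (rule linear_coefficient_zero)
  then have "Q *v x = c *\<^sub>R x" by (simp add: y_def)
  with xx x show ?thesis by (intro that[of x c]) auto
qed

text \<open>An orthonormal family of eigenvectors of maximal cardinality must span: its orthogonal
  complement \<open>W\<close> is invariant under \<open>Q\<close>, so a nonzero \<open>W\<close>
  would contain a further eigenvector that extends the family.\<close>

lemma symmetric_orthonormal_eigenbasis:
  fixes Q :: "real^'n^'n"
  assumes sym: "transpose Q = Q"
  obtains B c where "finite B" "\<And>a b. a \<in> B \<Longrightarrow> b \<in> B \<Longrightarrow> a \<bullet> b = (if a = b then 1 else 0)"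
    "span B = UNIV" "\<And>b. b \<in> B \<Longrightarrow> Q *v b = c b *\<^sub>R b"
proof -
  define ok where "ok B \<longleftrightarrow> pairwise orthogonal B \<and> (\<forall>b\<in>B. norm b = 1 \<and> (\<exists>c. Q *v b = c *\<^sub>R b))"
    for B :: "(real^'n) set"
  have card: "finite B \<and> card B \<le> CARD('n)" if "ok B" for B
  proof -
    have "0 \<notin> B" using that unfolding ok_def by (metis norm_zero zero_neq_one)
    then have "independent B"
      using that pairwise_orthogonal_independent unfolding ok_def by blast
    then show ?thesis using independent_bound[of B] by simp
  qed
  have "ok {}" by (simp add: ok_def)
  then have "\<exists>B. ok B \<and> (\<forall>C. ok C \<longrightarrow> card C \<le> card B)"
    using ex_has_greatest_nat[of ok "{}" card "Suc CARD('n)", OF \<open>ok {}\<close>] card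
    by (simp add: less_Suc_eq_le)
  then obtain B where B: "ok B" and max: "\<And>C. ok C \<Longrightarrow> card C \<le> card B" by blast
  define W where "W = {y. \<forall>b\<in>B. b \<bullet> y = 0}"
  have "subspace W" unfolding W_def subspace_def by (auto simp: inner_add_right)
  have inv: "Q *v y \<in> W" if "y \<in> W" for y
    unfolding W_def
  proof safe
    fix b assume "b \<in> B"
    then obtain c where "Q *v b = c *\<^sub>R b" using B by (auto simp: ok_def)
    then show "b \<bullet> (Q *v y) = 0"
      using that \<open>b \<in> B\<close> by (simp add: symmetric_inner_commute[OF sym, symmetric] W_def)
  qed
  have "W = {0}"
  proof (rule ccontr)
    assume "W \<noteq> {0}"
    then obtain x c where x: "x \<in> W" "norm x = 1" "Q *v x = c *\<^sub>R x"
      using symmetric_eigenvector_in_subspace[OF sym \<open>subspace W\<close> _ inv] by metis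
    then have xb: "b \<bullet> x = 0" if "b \<in> B" for b using that by (auto simp: W_def)
    then have "x \<notin> B" using x(2) by (metis inner_eq_zero_iff norm_zero zero_neq_one)
    have "ok (insert x B)"
      using B x xb unfolding ok_def
      by (auto simp: pairwise_insert orthogonal_def inner_commute)
    then have "card (insert x B) \<le> card B" by (rule max)
    with \<open>x \<notin> B\<close> card[OF B] show False by simp
  qed
  have "x \<in> span B" for x
  proof -
    obtain y z where "y \<in> span B" "\<And>w. w \<in> span B \<Longrightarrow> orthogonal z w" "x = y + z"
      using orthogonal_subspace_decomp_exists[of B x] by metis
    moreover from this have "z \<in> W"
      by (auto simp: W_def orthogonal_def inner_commute span_base)
    ultimately show ?thesis using \<open>W = {0}\<close> by simp
  qed
  then have "span B = UNIV" by blast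
  moreover have "a \<bullet> b = (if a = b then 1 else 0)" if "a \<in> B" "b \<in> B" for a b
    using B that by (auto simp: ok_def pairwise_def orthogonal_def norm_eq_1)
  moreover obtain c where "\<And>b. b \<in> B \<Longrightarrow> Q *v b = c b *\<^sub>R b"
    using B unfolding ok_def by metis
  ultimately show ?thesis using that card[OF B] by metis
qed

section \<open>Square roots of positive semidefinite matrices\<close>

lemma psd_sqrt_exists:
  fixes Q :: "real^'n^'n"
  assumes "psd Q"
  shows "\<exists>S. psd S \<and> S ** S = Q"
proof -
  have sym: "transpose Q = Q" using assms by (simp add: psd_def)
  obtain B c where B: "finite B" "\<And>a b. a \<in> B \<Longrightarrow> b \<in> B \<Longrightarrow> a \<bullet> b = (if a = b then 1 else 0)"
    "span B = UNIV" "\<And>b. b \<in> B \<Longrightarrow> Q *v b = c b *\<^sub>R b"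
    using symmetric_orthonormal_eigenbasis[OF sym] by metis
  have c: "c b \<ge> 0" if "b \<in> B" for b
    using assms B(2)[of b b] B(4)[OF that] that unfolding psd_def
    by (metis inner_scaleR_right mult.right_neutral)
  \<comment> \<open>\<open>f\<close> acts on the eigenbasis by the square roots of the
    eigenvalues.\<close>
  define f where "f x = (\<Sum>b\<in>B. (sqrt (c b) * (b \<bullet> x)) *\<^sub>R b)" for x
  have "linear f"
    unfolding f_def
    by (intro linearI) (auto simp: inner_add_right algebra_simps sum.distrib scaleR_sum_right)
  define S where "S = matrix f"
  have S: "S *v x = f x" for x unfolding S_def using \<open>linear f\<close> by (simp add: matrix_works)
  have Sb: "S *v b = sqrt (c b) *\<^sub>R b" if "b \<in> B" for b
  proof -
    have "f b = (\<Sum>a\<in>B. if a = b then sqrt (c a) *\<^sub>R a else 0)"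
      unfolding f_def by (rule sum.cong) (use B(2) that in auto)
    then show ?thesis using B(1) that S by simp
  qed
  have inner: "x \<bullet> (S *v y) = (\<Sum>b\<in>B. sqrt (c b) * (b \<bullet> x) * (b \<bullet> y))" for x y
    by (simp add: S f_def inner_sum_right mult_ac inner_commute)
  have "x \<bullet> (transpose S *v y) = x \<bullet> (S *v y)" for x y
    by (subst inner_commute, subst inner_transpose_mult) (simp add: inner mult_ac)
  then have "\<forall>y. transpose S *v y = S *v y"
    using vector_eq_ldot by blast
  then have "transpose S = S"
    unfolding matrix_eq .
  moreover have "0 \<le> x \<bullet> (S *v x)" for x
    unfolding inner by (intro sum_nonneg) (auto simp: c mult.assoc)
  ultimately have "psd S" by (simp add: psd_def)
  moreover have "(S ** S) *v x = Q *v x" for x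
  proof (rule linear_eq_on[where B = B and f = "(*v) (S ** S)" and g = "(*v) Q"])
    show "x \<in> span B" using B(3) by simp
    fix b assume "b \<in> B"
    then show "(S ** S) *v b = Q *v b"
      using B(4) Sb c
      by (simp add: matrix_vector_mul_assoc[symmetric] matrix_vector_mult_scaleR)
  qed auto
  then have "S ** S = Q" by (simp add: matrix_eq)
  ultimately show ?thesis by blast
qed

text \<open>Every positive semidefinite root \<open>U\<close> acts on an eigenvector
  \<open>b\<close> of \<open>Q\<close> in the same way, as multiplication by
  \<open>sqrt (c b)\<close>. Two roots thus agree on a spanning set.\<close>

lemma psd_sqrt_unique:
  fixes Q :: "real^'n^'n"
  assumes "psd S" "S ** S = Q" "psd T" "T ** T = Q"
  shows "S = T"
proof -
  have sym: "transpose Q = Q" using assms(1,2) by (auto simp: psd_def matrix_transpose_mul)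
  obtain B c where B: "span B = UNIV" "\<And>b. b \<in> B \<Longrightarrow> Q *v b = c b *\<^sub>R b"
    using symmetric_orthonormal_eigenbasis[OF sym] by metis
  have root: "U *v b = sqrt (c b) *\<^sub>R b" if "b \<in> B" "psd U" "U ** U = Q" for U b
  proof -
    have symU: "transpose U = U" and posU: "\<And>x. 0 \<le> x \<bullet> (U *v x)"
      using that by (auto simp: psd_def)
    have UU: "U *v (U *v b) = c b *\<^sub>R b"
      using that B by (simp add: matrix_vector_mul_assoc)
    have nrm: "(U *v b) \<bullet> (U *v b) = c b * (b \<bullet> b)"
      by (simp add: symmetric_inner_commute[OF symU] UU)
    consider "b = 0" | "c b = 0" | "c b > 0" "b \<noteq> 0"
      using nrm by (metis inner_ge_zero inner_gt_zero_iff linorder_neqE_linordered_idom mult_neg_pos not_le)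
    then show ?thesis
    proof cases
      case 2 then show ?thesis using nrm by simp
    next
      case 3
      let ?y = "U *v b - sqrt (c b) *\<^sub>R b"
      \<comment> \<open>Factor \<open>U^2 - c b\<close> as
        \<open>(U + sqrt (c b)) (U - sqrt (c b))\<close>: the vector \<open>?y\<close> would be an
        eigenvector of \<open>U\<close> with a negative eigenvalue, unless it is zero.\<close>
      have "U *v ?y = - sqrt (c b) *\<^sub>R ?y"
        using 3 by (simp add: matrix_vector_mult_diff_distrib matrix_vector_mult_scaleR UU scaleR_diff_right)
      then have "?y \<bullet> (U *v ?y) = - sqrt (c b) * (?y \<bullet> ?y)" by (simp only: inner_scaleR_right)
      moreover have "0 \<le> ?y \<bullet> (U *v ?y)" by (rule posU)
      ultimately have "?y \<bullet> ?y \<le> 0" using 3 by (simp add: mult_le_0_iff)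
      then have "?y = 0" by (metis inner_eq_zero_iff inner_ge_zero order_antisym)
      then show ?thesis by simp
    qed simp
  qed
  have "S *v x = T *v x" for x
    by (rule linear_eq_on[where B = B and f = "(*v) S" and g = "(*v) T"])
      (use B root assms in auto)
  then show ?thesis by (simp add: matrix_eq)
qed

lemma psd_sqrt:
  assumes "psd Q"
  shows "psd (psd_sqrt Q)" "psd_sqrt Q ** psd_sqrt Q = Q"
proof -
  have "\<exists>!S. psd S \<and> S ** S = Q"
    using psd_sqrt_exists[OF assms] psd_sqrt_unique by blast
  from theI'[OF this] show "psd (psd_sqrt Q)" "psd_sqrt Q ** psd_sqrt Q = Q"
    unfolding psd_sqrt_def by auto
qed

lemma psd_sqrt_inner:
  assumes "psd Q"
  shows "(psd_sqrt Q *v x) \<bullet> (psd_sqrt Q *v x) = x \<bullet> (Q *v x)"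
  using psd_sqrt[OF assms]
  by (metis matrix_vector_mul_assoc psd_def symmetric_inner_commute)

text \<open>Splitting \<open>D\<close> into its square root twice and cycling one factor to the
  front displays the trace as a sum of values of the form of \<open>V\<close>. Sign and vanishing of
  the trace can then be read off summand by summand.\<close>

lemma trace_mult_psd:
  fixes V D :: "real^'n^'n"
  assumes "psd D"
  shows "trace (V ** D) = (\<Sum>i\<in>UNIV. column i (psd_sqrt D) \<bullet> (V *v column i (psd_sqrt D)))"
proof -
  let ?S = "psd_sqrt D"
  have S: "transpose ?S = ?S" "?S ** ?S = D" using psd_sqrt[OF assms] by (auto simp: psd_def)
  have "trace (V ** D) = trace ((V ** ?S) ** ?S)" by (simp add: S(2) matrix_mul_assoc[symmetric])
  also have "\<dots> = trace (transpose ?S ** (V ** ?S))" by (subst trace_mul_sym) (simp add: S(1))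
  also have "\<dots> = (\<Sum>i\<in>UNIV. column i ?S \<bullet> (V *v column i ?S))"
    by (simp add: trace_def matrix_matrix_mult_def transpose_def column_def inner_vec_def matrix_vector_mult_def)
  finally show ?thesis .
qed

lemma trace_mult_psd_nonneg:
  assumes "psd V" "psd D"
  shows "0 \<le> trace (V ** D)"
  unfolding trace_mult_psd[OF assms(2)] by (intro sum_nonneg) (use assms(1) in \<open>auto simp: psd_def\<close>)

text \<open>This strictness serves twice: it makes the optimal \<open>M\<close> unique, and with
  \<open>V\<close> the identity it turns a subsolution of maximal trace into a fixed point.\<close>

lemma trace_mult_pd_eq_0:
  assumes "pd V" "psd D" "trace (V ** D) \<le> 0"
  shows "D = 0"
proof -
  let ?q = "\<lambda>i. column i (psd_sqrt D) \<bullet> (V *v column i (psd_sqrt D))"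
  have nonneg: "0 \<le> ?q i" for i
    using assms(1) by (cases "column i (psd_sqrt D) = 0") (auto simp: pd_def less_imp_le)
  have "sum ?q UNIV = 0"
    using assms(3) sum_nonneg[of UNIV ?q] nonneg unfolding trace_mult_psd[OF assms(2)] by fastforce
  then have "?q i = 0" for i using nonneg by (simp add: sum_nonneg_eq_0_iff)
  then have "column i (psd_sqrt D) = 0" for i using assms(1) unfolding pd_def by (metis less_irrefl)
  then have "psd_sqrt D = 0" by (simp add: column_def vec_eq_iff)
  then show ?thesis using psd_sqrt(2)[OF assms(2)] by simp
qed

lemma psd_if_pd: "pd M \<Longrightarrow> psd M"
  unfolding pd_def psd_def by (metis inner_zero_left order.refl less_imp_le)

lemma psd_add: "psd M \<Longrightarrow> psd N \<Longrightarrow> psd (M + N)"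
  by (simp add: psd_def transpose_matrix_add matrix_vector_mult_add_rdistrib inner_add_right)

lemma pd_psd_add: "pd M \<Longrightarrow> psd N \<Longrightarrow> pd (M + N)"
  by (simp add: pd_def psd_def transpose_matrix_add matrix_vector_mult_add_rdistrib inner_add_right
      add_pos_nonneg)

lemma pd_matrix_inv:
  fixes N :: "real^'n^'n"
  assumes "pd N"
  shows "N ** matrix_inv N = mat 1" "matrix_inv N ** N = mat 1"
    "transpose (matrix_inv N) = matrix_inv N"
proof -
  have "x = 0" if "N *v x = 0" for x
    using assms that unfolding pd_def by (metis inner_zero_right less_irrefl)
  then have "invertible N"
    by (metis invertible_left_inverse matrix_left_invertible_ker)
  then have "N ** matrix_inv N = mat 1 \<and> matrix_inv N ** N = mat 1"
    unfolding invertible_def matrix_inv_def by (rule someI_ex)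
  then show 1: "N ** matrix_inv N = mat 1" and 2: "matrix_inv N ** N = mat 1" by auto
  have "transpose (matrix_inv N) ** N = mat 1"
    using 1 assms by (metis matrix_transpose_mul pd_def transpose_mat)
  then show "transpose (matrix_inv N) = matrix_inv N"
    using 1 by (metis matrix_mul_assoc matrix_mul_lid matrix_mul_rid)
qed

subsection \<open>Powers of Schur stable matrices\<close>

text \<open>The vector p(N) v. Only the orbit of one vector under \<open>N\<close> occurs, so no
  algebra of matrix polynomials is involved.\<close>

definition poly_apply :: "complex^'n^'n \<Rightarrow> complex poly \<Rightarrow> complex^'n \<Rightarrow> complex^'n" where
  "poly_apply N p v = (\<Sum>i\<le>degree p. coeff p i *s (((*v) N ^^ i) v))"

lemma poly_apply_upto:
  assumes "degree p \<le> k"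
  shows "poly_apply N p v = (\<Sum>i\<le>k. coeff p i *s (((*v) N ^^ i) v))"
  unfolding poly_apply_def
  by (rule sum.mono_neutral_left) (use assms in \<open>auto simp: coeff_eq_0\<close>)

lemma matrix_funpow_diff_scale:
  fixes N :: "'a::field^'n^'n"
  shows "((*v) N ^^ k) (v - z *s w) = ((*v) N ^^ k) v - z *s ((*v) N ^^ k) w"
  by (induction k) (auto simp: matrix_vector_mult_diff_distrib vector_scalar_commute[symmetric])

lemma matrix_vector_mult_sum_scale:
  fixes N :: "'a::field^'n^'n"
  shows "N *v (\<Sum>i\<in>I. c i *s w i) = (\<Sum>i\<in>I. c i *s (N *v w i))"
  by (induction I rule: infinite_finite_induct)
    (auto simp: matrix_vector_right_distrib vector_scalar_commute)

text \<open>The factor N - z may act before q(N) or after it. The first form passes the annihilator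
  \<open>q\<close> on to \<open>N *v v - z *s v\<close>; the second exhibits
  \<open>poly_apply N q v\<close> as a solution of the eigenvector equation for
  \<open>z\<close>.\<close>

lemma poly_apply_linear_factor:
  "poly_apply N ([:- z, 1:] * q) v = poly_apply N q (N *v v - z *s v)" (is "?L = ?R")
  "poly_apply N ([:- z, 1:] * q) v = N *v poly_apply N q v - z *s poly_apply N q v" (is "?L = ?S")
proof -
  let ?k = "degree q"
  let ?u = "\<lambda>i. ((*v) N ^^ i) v"
  have p: "[:- z, 1:] * q = pCons 0 q - smult z q"
    by (simp add: mult_pCons_left)
  have "degree ([:- z, 1:] * q) \<le> Suc ?k"
    using degree_mult_le[of "[:- z, 1:]" q] by (simp add: split: if_splits)
  then have "?L = (\<Sum>i\<le>Suc ?k. coeff (pCons 0 q - smult z q) i *s ?u i)"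
    unfolding p by (rule poly_apply_upto)
  also have "\<dots> = (\<Sum>i\<le>Suc ?k. coeff (pCons 0 q) i *s ?u i) - (\<Sum>i\<le>Suc ?k. (z * coeff q i) *s ?u i)"
    by (simp add: sum_subtractf[symmetric] vector_sub_rdistrib del: sum.atMost_Suc)
  also have "(\<Sum>i\<le>Suc ?k. coeff (pCons 0 q) i *s ?u i) = (\<Sum>i\<le>?k. coeff q i *s ?u (Suc i))"
    by (subst sum.atMost_Suc_shift) simp
  also have "(\<Sum>i\<le>Suc ?k. (z * coeff q i) *s ?u i) = (\<Sum>i\<le>?k. (z * coeff q i) *s ?u i)"
    by (simp add: coeff_eq_0)
  finally have L: "?L = (\<Sum>i\<le>?k. coeff q i *s ?u (Suc i)) - (\<Sum>i\<le>?k. (z * coeff q i) *s ?u i)" .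
  show "?L = ?R"
    unfolding L unfolding poly_apply_def matrix_funpow_diff_scale vector_ssub_ldistrib sum_subtractf
    by (simp add: funpow_swap1 vector_smult_assoc mult.commute)
  show "?L = ?S"
    unfolding L unfolding poly_apply_def matrix_vector_mult_sum_scale
    by (simp add: vec.scale_sum_right vector_smult_assoc)
qed

text \<open>The n + 1 vectors v, N v, ..., N^n v of an n-dimensional space are linearly dependent,
  and the coefficients of a dependence are those of the polynomial.\<close>

lemma exists_annihilating_poly:
  fixes N :: "complex^'n^'n"
  shows "\<exists>p. p \<noteq> 0 \<and> poly_apply N p v = 0"
\<comment> \<open>Linear dependence is a property of sets, so a repetition in the orbit is treated
  apart: it yields a difference of two monomials.\<close>
proof (cases "inj_on (\<lambda>i. ((*v) N ^^ i) v) {..CARD('n)}")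
  case False
  then obtain i j where ij: "i \<noteq> j" "((*v) N ^^ i) v = ((*v) N ^^ j) v"
    by (auto simp: inj_on_def)
  let ?p = "monom 1 i - monom 1 j :: complex poly"
  have "coeff ?p i \<noteq> 0" using ij by simp
  then have "?p \<noteq> 0" by (metis coeff_0)
  have "poly_apply N ?p v = (\<Sum>l\<le>max i j. coeff ?p l *s (((*v) N ^^ l) v))"
    by (rule poly_apply_upto) (auto intro!: degree_diff_le simp: degree_monom_le le_max_iff_disj degree_monom_eq)
  also have "\<dots> = (\<Sum>l\<le>max i j. (if i = l then 1 else 0) *s (((*v) N ^^ l) v))
      - (\<Sum>l\<le>max i j. (if j = l then 1 else 0) *s (((*v) N ^^ l) v))"
    by (simp add: sum_subtractf[symmetric] vector_sub_rdistrib)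
  also have "\<dots> = 0"
    using ij by (simp add: if_distrib[of "\<lambda>c. c *s _"] cong: if_cong)
  finally show ?thesis using \<open>?p \<noteq> 0\<close> by blast
next
  case True
  let ?u = "\<lambda>i. ((*v) N ^^ i) v"
  let ?S = "?u ` {..CARD('n)}"
  have "card ?S = Suc CARD('n)" using True by (simp add: card_image)
  then have "vec.dim (UNIV :: (complex^'n) set) < card ?S" by (simp only: vec_dim_card)
  then have "vec.dependent ?S"
    using vec.independent_card_le_dim[of ?S UNIV] by force
  then obtain c where c: "\<exists>w\<in>?S. c w \<noteq> 0" "(\<Sum>w\<in>?S. c w *s w) = 0"
    by (auto simp: vec.dependent_finite)
  define p where "p = Poly (map (\<lambda>i. c (?u i)) [0..<Suc CARD('n)])"
  have coeff: "coeff p i = c (?u i)" if "i \<le> CARD('n)" for i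
    unfolding p_def using that by (simp add: nth_default_def del: upt_Suc)
  have "p \<noteq> 0" using c(1) coeff by force
  have "degree p < Suc CARD('n)"
    unfolding p_def by (rule degree_lessI) (auto simp: nth_default_def simp del: upt_Suc)
  then have "poly_apply N p v = (\<Sum>i\<le>CARD('n). coeff p i *s ?u i)"
    by (intro poly_apply_upto) simp
  also have "\<dots> = (\<Sum>w\<in>?S. c w *s w)"
    using True by (simp add: sum.reindex coeff)
  finally show ?thesis using \<open>p \<noteq> 0\<close> c by auto
qed

lemma perturbed_contraction_tendsto_0:
  fixes a w :: "nat \<Rightarrow> 'a::real_normed_vector" and c :: real
  assumes rec: "\<And>k. norm (a (Suc k)) \<le> c * norm (a k) + norm (w k)"
    and c: "0 \<le> c" "c < 1" and w: "w \<longlonglongrightarrow> 0"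
  shows "a \<longlonglongrightarrow> 0"
proof (rule LIMSEQ_I)
  fix e :: real assume "0 < e"
  \<comment> \<open>Chosen so that \<open>e / 2\<close> is the fixed point of the map sending t to
    \<open>c * t + d\<close>; once the disturbance is below \<open>d\<close>, the excess of the norm
    over \<open>e / 2\<close> contracts by the factor \<open>c\<close>.\<close>
  define d where "d = (1 - c) * (e / 2)"
  have "0 < d" using c \<open>0 < e\<close> by (simp add: d_def)
  then obtain k0 where k0: "\<And>k. k \<ge> k0 \<Longrightarrow> norm (w k) < d"
    using LIMSEQ_D[OF w] by (metis diff_zero)
  have bound: "norm (a (k0 + j)) - e / 2 \<le> c ^ j * (norm (a k0) - e / 2 + e / 2)" for j
  proof (induction j)
    case (Suc j)
    have "norm (a (k0 + Suc j)) - e / 2 \<le> c * norm (a (k0 + j)) + d - e / 2"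
      using rec[of "k0 + j"] k0[of "k0 + j"] by simp
    also have "\<dots> = c * (norm (a (k0 + j)) - e / 2)"
      by (simp add: d_def field_simps)
    also have "\<dots> \<le> c * (c ^ j * (norm (a k0) - e / 2 + e / 2))"
      using c Suc by (intro mult_left_mono) auto
    finally show ?case by simp
  qed (use \<open>0 < e\<close> in simp)
  have "(\<lambda>j. c ^ j * norm (a k0)) \<longlonglongrightarrow> 0"
    using c by (intro tendsto_mult_left_zero LIMSEQ_power_zero) auto
  from LIMSEQ_D[OF this, of "e / 2"] obtain j0
    where "\<And>j. j \<ge> j0 \<Longrightarrow> norm (c ^ j * norm (a k0) - 0) < e / 2"
    using \<open>0 < e\<close> by auto
  then have j0: "c ^ j * norm (a k0) < e / 2" if "j \<ge> j0" for j
    using that by (metis abs_ge_self diff_zero le_less_trans real_norm_def)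
  show "\<exists>no. \<forall>k\<ge>no. norm (a k - 0) < e"
  proof (intro exI allI impI)
    fix k assume "k \<ge> k0 + j0"
    then show "norm (a k - 0) < e"
      using bound[of "k - k0"] j0[of "k - k0"] by (simp add: le_diff_conv2 field_simps)
  qed
qed

lemma norm_vector_scalar_mult:
  fixes v :: "complex^'n"
  shows "norm (z *s v) = cmod z * norm v"
  by (simp add: norm_vec_def norm_mult L2_set_right_distrib)

text \<open>Induction on the degree of an annihilating polynomial, in place of a Jordan form. Split
  off a root \<open>z\<close>. If \<open>cmod z < 1\<close>, the orbit of \<open>v\<close> is a
  contraction by \<open>z\<close> perturbed by the orbit of \<open>N *v v - z *s v\<close>, which
  has an annihilator of smaller degree. Otherwise \<open>z\<close> cannot be an eigenvalue, so the
  quotient \<open>q\<close> already annihilates \<open>v\<close>.\<close>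

lemma annihilated_powers_tendsto_0:
  fixes N :: "complex^'n^'n"
  assumes stable: "\<And>z v. v \<noteq> 0 \<Longrightarrow> N *v v = z *s v \<Longrightarrow> cmod z < 1"
    and "p \<noteq> 0" "poly_apply N p v = 0"
  shows "(\<lambda>k. ((*v) N ^^ k) v) \<longlonglongrightarrow> 0"
  using assms(2,3)
proof (induction "degree p" arbitrary: p v)
  case 0
  then obtain a where "p = [:a:]" using degree0_coeffs[of p] by auto
  with 0 have "a \<noteq> 0" "a *s v = 0" by (auto simp: poly_apply_def)
  then have "v = 0" by (simp add: vec.scale_eq_0_iff)
  have "((*v) N ^^ k) 0 = 0" for k by (induction k) auto
  with \<open>v = 0\<close> show ?case by simp
next
  case (Suc d)
  have "\<not> constant (poly p)" using Suc.hyps(2) by (simp add: constant_degree)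
  then obtain z where "poly p z = 0" using fundamental_theorem_of_algebra by blast
  then obtain q where q: "p = [:- z, 1:] * q" by (metis poly_eq_0_iff_dvd dvdE)
  then have "q \<noteq> 0" using Suc.prems by auto
  have "degree p = Suc (degree q)"
    unfolding q using \<open>q \<noteq> 0\<close> by (subst degree_mult_eq) auto
  with Suc.hyps(2) have d: "d = degree q" by simp
  show ?case
  proof (cases "cmod z < 1")
    case True
    let ?w = "N *v v - z *s v"
    have "(\<lambda>k. ((*v) N ^^ k) ?w) \<longlonglongrightarrow> 0"
      using Suc.hyps(1)[OF d \<open>q \<noteq> 0\<close>] Suc.prems(2) poly_apply_linear_factor(1)[of N z q v] q by simp
    moreover have "norm (((*v) N ^^ Suc k) v) \<le> cmod z * norm (((*v) N ^^ k) v) + norm (((*v) N ^^ k) ?w)" for k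
    proof -
      have "((*v) N ^^ Suc k) v = z *s ((*v) N ^^ k) v + ((*v) N ^^ k) ?w"
        unfolding matrix_funpow_diff_scale by (simp add: funpow_swap1)
      then show ?thesis
        by (metis norm_triangle_ineq norm_vector_scalar_mult)
    qed
    ultimately show ?thesis
      using True perturbed_contraction_tendsto_0[of "\<lambda>k. ((*v) N ^^ k) v" "cmod z" "\<lambda>k. ((*v) N ^^ k) ?w"]
      by simp
  next
    case False
    have "N *v poly_apply N q v = z *s poly_apply N q v"
      using Suc.prems(2) poly_apply_linear_factor(2)[of N z q v] q by simp
    with stable False have "poly_apply N q v = 0" by blast
    with Suc.hyps(1)[OF d \<open>q \<noteq> 0\<close>] show ?thesis by simp
  qed
qed

lemma schur_stable_powers_tendsto_0:
  fixes M :: "real^'n^'n"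
  assumes "schur_stable M"
  shows "(\<lambda>k. ((*v) M ^^ k) x) \<longlonglongrightarrow> 0"
proof -
  define N :: "complex^'n^'n" where "N = (\<chi> i j. complex_of_real (M $ i $ j))"
  define c :: "real^'n \<Rightarrow> complex^'n" where "c = (\<lambda>x. \<chi> i. complex_of_real (x $ i))"
  have "N *v c y = c (M *v y)" for y
    by (simp add: N_def c_def matrix_vector_mult_def vec_eq_iff)
  then have pow: "((*v) N ^^ k) (c x) = c (((*v) M ^^ k) x)" for k
    by (induction k) auto
  obtain p where "p \<noteq> 0" "poly_apply N p (c x) = 0" using exists_annihilating_poly by blast
  moreover have "cmod z < 1" if "v \<noteq> 0" "N *v v = z *s v" for z v
    using assms that unfolding schur_stable_def N_def by blast
  ultimately have "(\<lambda>k. ((*v) N ^^ k) (c x)) \<longlonglongrightarrow> 0"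
    using annihilated_powers_tendsto_0 by metis
  then have lim: "(\<lambda>k. c (((*v) M ^^ k) x)) \<longlonglongrightarrow> 0"
    by (simp only: pow)
  show ?thesis
  proof (rule vec_tendstoI)
    fix i
    have "(\<lambda>k. Re (c (((*v) M ^^ k) x) $ i)) \<longlonglongrightarrow> Re ((0::complex^'n) $ i)"
      by (intro tendsto_Re tendsto_vec_nth lim)
    then show "(\<lambda>k. ((*v) M ^^ k) x $ i) \<longlonglongrightarrow> 0 $ i" by (simp add: c_def)
  qed
qed

subsection \<open>Block matrices and Schur complements\<close>

definition stack :: "real^'n \<Rightarrow> real^'m \<Rightarrow> real^('n::finite + 'm::finite)" where
  "stack x u = (\<chi> i. case i of Inl a \<Rightarrow> x $ a | Inr b \<Rightarrow> u $ b)"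

lemma stack_exhaust: obtains x u where "z = stack x u"
  by (rule that[of "\<chi> a. z $ Inl a" "\<chi> b. z $ Inr b"])
    (simp add: stack_def vec_eq_iff split: sum.split)

lemma sum_UNIV_Plus:
  fixes f :: "'n::finite + 'm::finite \<Rightarrow> 'a::comm_monoid_add"
  shows "(\<Sum>i\<in>UNIV. f i) = (\<Sum>a\<in>UNIV. f (Inl a)) + (\<Sum>b\<in>UNIV. f (Inr b))"
  by (simp add: UNIV_Plus_UNIV[symmetric] sum.Plus del: UNIV_Plus_UNIV)

lemma inner_stack: "stack x u \<bullet> stack y v = x \<bullet> y + u \<bullet> v"
  by (simp add: inner_vec_def sum_UNIV_Plus stack_def)

lemma block_matrix_mult_stack:
  "block_matrix M11 M12 M21 M22 *v stack x u = stack (M11 *v x + M12 *v u) (M21 *v x + M22 *v u)"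
  by (simp add: vec_eq_iff block_matrix_def stack_def matrix_vector_mult_def sum_UNIV_Plus
      split: sum.split)

lemma row_blocks_mult_stack: "row_blocks A B *v stack x u = A *v x + B *v u"
  by (simp add: vec_eq_iff row_blocks_def stack_def matrix_vector_mult_def sum_UNIV_Plus)

lemma transpose_block_matrix:
  "transpose (block_matrix M11 M12 M21 M22) =
     block_matrix (transpose M11) (transpose M21) (transpose M12) (transpose M22)"
  by (simp add: vec_eq_iff block_matrix_def transpose_def split: sum.split)

lemma block_matrix_blocks:
  assumes "transpose F = F"
  shows "F = block_matrix (block11 F) (block12 F) (transpose (block12 F)) (block22 F)"
proof -
  have "F $ i $ j = F $ j $ i" for i j
    using arg_cong[OF assms, of "\<lambda>M. M $ j $ i"] by (simp add: transpose_def)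
  then have "F $ Inr b $ Inl a = F $ Inl a $ Inr b" for a b by blast
  then show ?thesis
    by (simp add: vec_eq_iff block_matrix_def transpose_def block11_def block12_def block22_def
        split: sum.split)
qed

lemma transpose_block11: "transpose F = F \<Longrightarrow> transpose (block11 F) = block11 F"
  by (simp add: vec_eq_iff transpose_def block11_def)

lemma transpose_schur_complement:
  assumes "transpose F = F" "pd (block22 F)"
  shows "transpose (schur_complement F) = schur_complement F"
  by (simp add: schur_complement_def transpose_matrix_diff transpose_block11 assms matrix_transpose_mul
      pd_matrix_inv matrix_mul_assoc)

text \<open>For fixed x, the vector \<open>gain F *v x\<close> minimises the quadratic form of
  \<open>F\<close> at [x; u] over u, when \<open>F\<close> is symmetric and \<open>block22 F\<close>
  is positive definite.\<close>

definition gain :: "real^('n::finite + 'm::finite)^('n::finite + 'm::finite) \<Rightarrow> real^'n^'m" where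
  "gain F = - (matrix_inv (block22 F) ** transpose (block12 F))"

lemma complete_square:
  fixes F :: "real^('n::finite + 'm::finite)^('n + 'm)"
  assumes sym: "transpose F = F" and pd: "pd (block22 F)"
  shows "stack x u \<bullet> (F *v stack x u) =
    x \<bullet> (schur_complement F *v x) + (u - gain F *v x) \<bullet> (block22 F *v (u - gain F *v x))"
proof -
  let ?N = "block22 F" and ?E = "block12 F"
  define y where "y = matrix_inv ?N *v (transpose ?E *v x)"
  \<comment> \<open>Here \<open>y\<close> is the negative of \<open>gain F *v x\<close>. This
    identity removes the inverse, and the remaining expansion is a comparison of cross
    terms.\<close>
  have Ny: "?N *v y = transpose ?E *v x"
    unfolding y_def by (simp only: matrix_vector_mul_assoc matrix_mul_assoc pd_matrix_inv[OF pd] matrix_mul_lid)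
  have symN: "transpose ?N = ?N" using pd by (simp add: pd_def)
  have g: "u - gain F *v x = u + y"
    by (simp add: gain_def uminus_matrix_vector_mult y_def matrix_vector_mul_assoc[symmetric] del: transpose_matrix_vector)
  have S: "schur_complement F *v x = block11 F *v x - ?E *v y"
    by (simp add: schur_complement_def matrix_vector_mult_diff_rdistrib y_def
        matrix_vector_mul_assoc[symmetric] del: transpose_matrix_vector)
  have ET: "w \<bullet> (transpose ?E *v x) = x \<bullet> (?E *v w)" for w
    by (subst inner_commute) (rule inner_transpose_mult)
  have "(u + y) \<bullet> (?N *v (u + y)) = u \<bullet> (?N *v u) + 2 * (u \<bullet> (?N *v y)) + y \<bullet> (?N *v y)"
  proof -
    have "y \<bullet> (?N *v u) = u \<bullet> (?N *v y)"
      by (metis symmetric_inner_commute[OF symN] inner_commute)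
    then show ?thesis
      by (simp add: matrix_vector_right_distrib inner_add_left inner_add_right)
  qed
  also have "\<dots> = u \<bullet> (?N *v u) + 2 * (x \<bullet> (?E *v u)) + x \<bullet> (?E *v y)"
    unfolding Ny ET ..
  finally have sq: "(u + y) \<bullet> (?N *v (u + y)) = u \<bullet> (?N *v u) + 2 * (x \<bullet> (?E *v u)) + x \<bullet> (?E *v y)" .
  have "F *v stack x u = stack (block11 F *v x + ?E *v u) (transpose ?E *v x + ?N *v u)"
    by (rule block_matrix_mult_stack[of "block11 F" ?E "transpose ?E" ?N, folded block_matrix_blocks[OF sym]])
  then have "stack x u \<bullet> (F *v stack x u) =
      x \<bullet> (block11 F *v x) + x \<bullet> (?E *v u) + (u \<bullet> (transpose ?E *v x) + u \<bullet> (?N *v u))"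
    by (simp only: inner_stack inner_add_right)
  also have "\<dots> = x \<bullet> (block11 F *v x) + 2 * (x \<bullet> (?E *v u)) + u \<bullet> (?N *v u)"
    unfolding ET by simp
  finally show ?thesis
    unfolding g S sq by (simp add: inner_diff_right)
qed

subsection \<open>The Bellman form\<close>

text \<open>Stage cost at state x and input u, plus the discounted value of the noise-free successor
  state under the value function given by \<open>P\<close>.\<close>

definition bellman ::
  "real \<Rightarrow> real^'n^'n \<Rightarrow> real^'m^'n \<Rightarrow> real^'n^'n \<Rightarrow> real^'m^'m \<Rightarrow> real^'n^'n \<Rightarrow> real^'n \<Rightarrow> real^'m \<Rightarrow> real" where
  "bellman r A B Q R P x u =
     x \<bullet> (Q *v x) + u \<bullet> (R *v u) + r * ((A *v x + B *v u) \<bullet> (P *v (A *v x + B *v u)))"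

lemma congruence_inner:
  fixes P :: "real^'n^'n"
  shows "x \<bullet> ((transpose A ** P ** B) *v y) = (A *v x) \<bullet> (P *v (B *v y))"
proof -
  have "x \<bullet> ((transpose A ** P ** B) *v y) = x \<bullet> (transpose A *v (P *v (B *v y)))"
    by (simp only: matrix_vector_mul_assoc matrix_mul_assoc)
  also have "\<dots> = (A *v x) \<bullet> (P *v (B *v y))"
    by (subst (1 2) inner_commute) (rule inner_transpose_mult)
  finally show ?thesis .
qed

lemma transpose_congruence:
  fixes P :: "real^'n^'n"
  shows "transpose P = P \<Longrightarrow> transpose (transpose A ** P ** B) = transpose B ** P ** A"
  by (simp add: matrix_transpose_mul matrix_mul_assoc)

lemma q_matrix_blocks:
  "block11 (q_matrix r A B Q R P) = Q + r *\<^sub>R (transpose A ** P ** A)"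
  "block12 (q_matrix r A B Q R P) = r *\<^sub>R (transpose A ** P ** B)"
  "block22 (q_matrix r A B Q R P) = R + r *\<^sub>R (transpose B ** P ** B)"
  by (simp_all add: q_matrix_def block_matrix_def block11_def block12_def block22_def vec_eq_iff)

lemma transpose_q_matrix:
  assumes "transpose Q = Q" "transpose R = R" "transpose P = P"
  shows "transpose (q_matrix r A B Q R P) = q_matrix r A B Q R P"
  using assms
  by (simp add: q_matrix_def transpose_block_matrix transpose_matrix_add transpose_scalar transpose_congruence)

lemma q_matrix_form:
  assumes "transpose P = P"
  shows "stack x u \<bullet> (q_matrix r A B Q R P *v stack x u) = bellman r A B Q R P x u"
proof -
  have "stack x u \<bullet> (q_matrix r A B Q R P *v stack x u) =
     x \<bullet> (Q *v x) + u \<bullet> (R *v u) + r * ((A *v x) \<bullet> (P *v (A *v x)) + (A *v x) \<bullet> (P *v (B *v u))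
       + (B *v u) \<bullet> (P *v (A *v x)) + (B *v u) \<bullet> (P *v (B *v u)))"
    by (simp add: q_matrix_def block_matrix_mult_stack inner_stack inner_add_right
        matrix_vector_mult_add_rdistrib scaleR_matrix_vector_assoc[symmetric] congruence_inner algebra_simps)
  then show ?thesis
    by (simp add: bellman_def matrix_vector_right_distrib inner_add_left inner_add_right algebra_simps)
qed

lemma pd_block22_q_matrix:
  assumes "pd R" "psd P" "0 \<le> r"
  shows "pd (block22 (q_matrix r A B Q R P))"
proof -
  have "psd (r *\<^sub>R (transpose B ** P ** B))"
    using assms(2,3) unfolding psd_def
    by (simp add: transpose_scalar transpose_congruence scaleR_matrix_vector_assoc[symmetric] congruence_inner)
  then show ?thesis
    unfolding q_matrix_blocks using assms(1) by (rule pd_psd_add[rotated])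
qed

lemma gain_q_matrix:
  assumes "transpose P = P"
  shows "gain (q_matrix r A B Q R P) = optimal_gain r A B R P"
  by (simp add: gain_def q_matrix_blocks optimal_gain_def transpose_scalar transpose_congruence assms)

text \<open>The Riccati equation thereby becomes the fixed-point equation of dynamic programming:
  for positive semidefinite \<open>P\<close>, the Schur complement of
  \<open>q_matrix r A B Q R P\<close> is the form left after minimising \<open>bellman\<close> over
  the input.\<close>

lemma riccati_solution_iff_schur_complement:
  assumes "transpose P = P"
  shows "riccati_solution r A B Q R P \<longleftrightarrow> P = schur_complement (q_matrix r A B Q R P)"
proof -
  let ?Z = "matrix_inv (R + r *\<^sub>R (transpose B ** P ** B))"
  have "(r *\<^sub>R (transpose A ** P ** B)) ** ?Z ** transpose (r *\<^sub>R (transpose A ** P ** B))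
      = (r *\<^sub>R (transpose A ** P ** B)) ** ?Z ** (r *\<^sub>R (transpose B ** P ** A))"
    by (simp only: transpose_scalar transpose_congruence[OF assms])
  also have "\<dots> = r\<^sup>2 *\<^sub>R (transpose A ** P ** B ** ?Z ** (transpose B ** P ** A))"
    by (simp only: matrix_scalar_ac scalar_matrix_assoc[symmetric] scaleR_scaleR power2_eq_square)
  finally show ?thesis
    by (simp only: riccati_solution_def schur_complement_def q_matrix_blocks matrix_mul_assoc)
qed

lemma bellman_complete_square:
  assumes "transpose Q = Q" "pd R" "psd P" "0 \<le> r"
  shows "bellman r A B Q R P x u =
    x \<bullet> (schur_complement (q_matrix r A B Q R P) *v x)
    + (u - optimal_gain r A B R P *v x) \<bullet>
      (block22 (q_matrix r A B Q R P) *v (u - optimal_gain r A B R P *v x))"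
proof -
  have P: "transpose P = P" and R: "transpose R = R" using assms by (auto simp: psd_def pd_def)
  show ?thesis
    using complete_square[OF transpose_q_matrix[OF assms(1) R P] pd_block22_q_matrix[OF assms(2-4)], of x u]
    by (simp add: q_matrix_form gain_q_matrix P)
qed

lemma bellman_mono:
  assumes "0 \<le> r" "\<And>y. y \<bullet> (P *v y) \<le> y \<bullet> (S *v y)"
  shows "bellman r A B Q R P x u \<le> bellman r A B Q R S x u"
  unfolding bellman_def by (intro add_left_mono mult_left_mono assms)

text \<open>The constraint matrix, evaluated at \<open>stack x u\<close>, is the difference of the
  two sides of the Bellman inequality. Its symmetry follows from that of \<open>F\<close>,
  \<open>Q\<close> and \<open>R\<close>, so only the values of the form remain.\<close>

lemma feasible_iff_bellman:
  assumes "transpose Q = Q" "transpose R = R"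
  shows "feasible r A B Q R (F, M) \<longleftrightarrow>
    transpose F = F \<and> pd (block22 F) \<and> psd (schur_complement F - M) \<and>
    (\<forall>x u. stack x u \<bullet> (F *v stack x u) \<le> bellman r A B Q R (schur_complement F) x u)"
proof -
  let ?S = "schur_complement F" and ?AB = "row_blocks A B"
  let ?G = "r *\<^sub>R (transpose ?AB ** ?S ** ?AB) - F + block_matrix Q 0 0 R"
  have feas: "feasible r A B Q R (F, M) \<longleftrightarrow>
      transpose F = F \<and> psd ?G \<and> pd (block22 F) \<and> psd (?S - M)"
    unfolding feasible_def by simp
  have form: "stack x u \<bullet> (?G *v stack x u) =
      bellman r A B Q R ?S x u - stack x u \<bullet> (F *v stack x u)" for x u
    by (simp add: matrix_vector_mult_add_rdistrib matrix_vector_mult_diff_rdistrib inner_diff_right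
        inner_add_right scaleR_matrix_vector_assoc[symmetric] congruence_inner row_blocks_mult_stack
        block_matrix_mult_stack inner_stack bellman_def)
  have "transpose ?G = ?G" if "transpose F = F" "pd (block22 F)"
    using that assms
    by (simp add: transpose_matrix_add transpose_matrix_diff transpose_scalar transpose_congruence
        transpose_block_matrix transpose_schur_complement) (simp add: transpose_def zero_vec_def)
  moreover have "(\<forall>z. 0 \<le> z \<bullet> (?G *v z)) \<longleftrightarrow> (\<forall>x u. 0 \<le> stack x u \<bullet> (?G *v stack x u))"
  proof (intro iffI allI)
    fix z assume "\<forall>x u. 0 \<le> stack x u \<bullet> (?G *v stack x u)"
    then show "0 \<le> z \<bullet> (?G *v z)" by (rule_tac z = z in stack_exhaust) blast
  qed blast
  ultimately show ?thesis
    using feas unfolding psd_def[of ?G] form by auto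
qed

section \<open>Definiteness of the weight\<close>

lemma outer_psd: "psd (outer v)"
proof -
  have "x \<bullet> (outer v *v x) = (v \<bullet> x)\<^sup>2" for x
    by (simp add: outer_def inner_vec_def matrix_vector_mult_def power2_eq_square sum_product
        sum_distrib_left mult_ac)
  then show ?thesis by (simp add: psd_def) (simp add: outer_def transpose_def vec_eq_iff mult.commute)
qed

lemma pd_second_moment:
  assumes "pd \<Sigma>0" "psd \<Sigma>" "0 < r" "r < 1"
  shows "pd (second_moment r \<mu>0 \<Sigma>0 \<Sigma>)"
proof -
  have "psd ((r / (1 - r)) *\<^sub>R \<Sigma>)"
    using assms by (simp add: psd_def transpose_scalar scaleR_matrix_vector_assoc[symmetric])
  then show ?thesis
    unfolding second_moment_def by (intro pd_psd_add assms outer_psd)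
qed

subsection \<open>Bounds from stable powers\<close>

lemma linear_funpow: "linear f \<Longrightarrow> linear (f ^^ k)" for f :: "'a::real_vector \<Rightarrow> 'a"
  by (induction k) (auto simp: linear_id[unfolded id_def] id_def linear_compose)

text \<open>A finite-dimensional uniform boundedness principle: convergent orbits of the finitely
  many basis vectors are bounded, and linearity carries the bound over to all vectors.\<close>

lemma stable_powers_bounded:
  fixes f :: "'a::euclidean_space \<Rightarrow> 'a"
  assumes lin: "linear f" and lim: "\<And>x. (\<lambda>k. (f ^^ k) x) \<longlonglongrightarrow> 0"
  obtains C where "0 \<le> C" "\<And>k x. norm ((f ^^ k) x) \<le> C * norm x"
proof -
  have "\<exists>c. \<forall>k. norm ((f ^^ k) b) \<le> c" for b
    using convergent_imp_Bseq[OF convergentI[OF lim]] unfolding Bseq_def by blast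
  then obtain c where c: "\<And>b k. norm ((f ^^ k) b) \<le> c b" by metis
  have c0: "0 \<le> c b" for b using c[of 0 b] norm_ge_zero order_trans by blast
  show thesis
  proof (rule that[of "sum c Basis"])
    show "0 \<le> sum c Basis" by (intro sum_nonneg c0)
    fix k x
    have "(f ^^ k) x = (f ^^ k) (\<Sum>b\<in>Basis. (x \<bullet> b) *\<^sub>R b)"
      by (simp add: euclidean_representation)
    also have "\<dots> = (\<Sum>b\<in>Basis. (x \<bullet> b) *\<^sub>R (f ^^ k) b)"
      using linear_funpow[OF lin, of k] by (simp add: linear_sum linear_scale)
    also have "norm \<dots> \<le> (\<Sum>b\<in>Basis. norm x * c b)"
    proof (rule sum_norm_le)
      fix b :: 'a assume "b \<in> Basis"
      then show "norm ((x \<bullet> b) *\<^sub>R (f ^^ k) b) \<le> norm x * c b"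
        by (simp add: Basis_le_norm c mult_mono)
    qed
    finally show "norm ((f ^^ k) x) \<le> sum c Basis * norm x"
      by (simp add: sum_distrib_left mult.commute)
  qed
qed

lemma stable_form_tendsto_0:
  fixes M S :: "real^'n^'n"
  assumes "schur_stable M"
  shows "(\<lambda>k. ((*v) M ^^ k) x \<bullet> (S *v (((*v) M ^^ k) x))) \<longlonglongrightarrow> 0"
proof -
  have lim: "(\<lambda>k. ((*v) M ^^ k) x) \<longlonglongrightarrow> 0"
    using assms by (rule schur_stable_powers_tendsto_0)
  have "bounded_linear ((*v) S)" by simp
  from bounded_linear.tendsto[OF this lim]
  have "(\<lambda>k. S *v (((*v) M ^^ k) x)) \<longlonglongrightarrow> S *v 0" .
  from tendsto_inner[OF lim this] show ?thesis by simp
qed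

lemma quadratic_form_bound:
  fixes W :: "real^'n^'n"
  obtains c where "0 \<le> c" "\<And>x. x \<bullet> (W *v x) \<le> c * (norm x)\<^sup>2"
proof -
  have "bounded_linear ((*v) W)" by simp
  then obtain c where c: "0 \<le> c" "\<And>x. norm (W *v x) \<le> norm x * c"
    using bounded_linear.nonneg_bounded by blast
  have "x \<bullet> (W *v x) \<le> c * (norm x)\<^sup>2" for x
  proof -
    have "x \<bullet> (W *v x) \<le> norm x * norm (W *v x)" by (rule norm_cauchy_schwarz)
    also have "\<dots> \<le> norm x * (norm x * c)" by (intro mult_left_mono c) simp
    finally show ?thesis by (simp add: power2_eq_square mult_ac)
  qed
  with c that show thesis by blast
qed

text \<open>Testing positivity at the sum and the difference of two unit vectors bounds each
  off-diagonal entry by diagonal ones. A bound on the form thus becomes a norm bound, as compactness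
  of \<open>subsolutions\<close> requires.\<close>

lemma psd_norm_le:
  fixes S :: "real^'n^'n"
  assumes "psd S" "\<And>x. x \<bullet> (S *v x) \<le> c * (norm x)\<^sup>2"
  shows "norm S \<le> real CARD('n) * (real CARD('n) * c)"
proof -
  have sym: "transpose S = S" and pos: "\<And>x. 0 \<le> x \<bullet> (S *v x)" using assms(1) by (auto simp: psd_def)
  have entry: "\<bar>S $ i $ j\<bar> \<le> c" for i j
  proof -
    let ?e = "axis i 1 :: real^'n" and ?f = "axis j 1 :: real^'n"
    have ij: "?e \<bullet> (S *v ?f) = S $ i $ j"
      by (simp add: inner_axis' matrix_vector_mult_basis column_def)
    then have ji: "?f \<bullet> (S *v ?e) = S $ i $ j"
      using symmetric_inner_commute[OF sym, of ?e ?f] by (simp add: inner_commute)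
    have "?e \<bullet> (S *v ?e) \<le> c" "?f \<bullet> (S *v ?f) \<le> c"
      using assms(2)[of ?e] assms(2)[of ?f] by auto
    moreover have "0 \<le> (?e + ?f) \<bullet> (S *v (?e + ?f))" "0 \<le> (?e - ?f) \<bullet> (S *v (?e - ?f))"
      by (rule pos)+
    then have "0 \<le> ?e \<bullet> (S *v ?e) + 2 * S $ i $ j + ?f \<bullet> (S *v ?f)"
      "0 \<le> ?e \<bullet> (S *v ?e) - 2 * S $ i $ j + ?f \<bullet> (S *v ?f)"
      by (simp_all only: matrix_vector_right_distrib matrix_vector_mult_diff_distrib
          inner_add_left inner_add_right inner_diff_left inner_diff_right ij ji)
    ultimately show ?thesis by linarith
  qed
  have "norm S \<le> (\<Sum>i\<in>UNIV. norm (S $ i))"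
    unfolding norm_vec_def[of S] by (rule L2_set_le_sum) simp
  also have "\<dots> \<le> (\<Sum>i\<in>(UNIV::'n set). \<Sum>j\<in>(UNIV::'n set). c)"
    by (intro sum_mono order_trans[OF norm_le_l1_cart] entry)
  finally show ?thesis by simp
qed

lemma complexification_eigen_iff:
  fixes M :: "real^'n^'n" and v :: "complex^'n"
  shows "(\<chi> i j. complex_of_real (M $ i $ j)) *v v = z *s v \<longleftrightarrow>
    M *v (\<chi> i. Re (v $ i)) = Re z *\<^sub>R (\<chi> i. Re (v $ i)) - Im z *\<^sub>R (\<chi> i. Im (v $ i)) \<and>
    M *v (\<chi> i. Im (v $ i)) = Im z *\<^sub>R (\<chi> i. Re (v $ i)) + Re z *\<^sub>R (\<chi> i. Im (v $ i))"
  by (auto simp: vec_eq_iff matrix_vector_mult_def complex_eq_iff algebra_simps)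

text \<open>The mixed terms of the two summands cancel. With \<open>\<alpha>\<close> and
  \<open>\<beta>\<close> the real and imaginary parts of an eigenvalue, the total form on the real
  and imaginary parts of an eigenvector is multiplied by the squared modulus.\<close>

lemma form_rotation:
  fixes P :: "real^'n^'n"
  assumes "transpose P = P"
  shows "(\<alpha> *\<^sub>R a - \<beta> *\<^sub>R b) \<bullet> (P *v (\<alpha> *\<^sub>R a - \<beta> *\<^sub>R b))
       + (\<beta> *\<^sub>R a + \<alpha> *\<^sub>R b) \<bullet> (P *v (\<beta> *\<^sub>R a + \<alpha> *\<^sub>R b))
       = (\<alpha>\<^sup>2 + \<beta>\<^sup>2) * (a \<bullet> (P *v a) + b \<bullet> (P *v b))"
  by (simp add: matrix_vector_right_distrib matrix_vector_mult_diff_distrib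
          inner_add_left inner_add_right inner_diff_left inner_diff_right matrix_vector_mult_scaleR
          power2_eq_square algebra_simps)

subsection \<open>The Riccati equation\<close>

locale lqr =
  fixes r :: real and A :: "real^'n^'n" and B :: "real^'m^'n" and Q :: "real^'n^'n" and R :: "real^'m^'m"
  assumes r: "0 < r" "r < 1" and Q: "psd Q" and R: "pd R"
    and stabilizable: "stabilizable A B" and detectable: "detectable A (psd_sqrt Q)"
begin

abbreviation "bell \<equiv> bellman r A B Q R"
abbreviation "H \<equiv> q_matrix r A B Q R"
abbreviation "L \<equiv> optimal_gain r A B R"
abbreviation "ric P \<equiv> psd P \<and> riccati_solution r A B Q R P"

lemma sym: "transpose Q = Q" "transpose R = R"
  using Q R by (auto simp: psd_def pd_def)

lemma form_nonneg: "0 \<le> x \<bullet> (Q *v x)" "0 \<le> u \<bullet> (R *v u)"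
  using Q psd_if_pd[OF R] by (auto simp: psd_def)

lemma bell_ge_schur:
  assumes "psd P"
  shows "x \<bullet> (schur_complement (H P) *v x) \<le> bell P x u"
    and "bell P x (L P *v x) = x \<bullet> (schur_complement (H P) *v x)"
proof -
  have "psd (block22 (H P))" using psd_if_pd[OF pd_block22_q_matrix[OF R assms]] r by simp
  then show "x \<bullet> (schur_complement (H P) *v x) \<le> bell P x u"
    using bellman_complete_square[OF sym(1) R assms, of r A B x u] r by (simp add: psd_def)
  show "bell P x (L P *v x) = x \<bullet> (schur_complement (H P) *v x)"
    using bellman_complete_square[OF sym(1) R assms, of r A B x "L P *v x"] r by simp
qed

lemma ric_schur:
  assumes "ric P"
  shows "schur_complement (H P) = P"
  using assms riccati_solution_iff_schur_complement[of P r A B Q R] by (auto simp: psd_def)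

text \<open>Absorbing \<open>sqrt r\<close> into the closed loop turns the discounted problem into
  an undiscounted one.\<close>

lemma bell_gain:
  "bell P x (K *v x) = x \<bullet> (Q *v x) + (K *v x) \<bullet> (R *v (K *v x))
     + ((sqrt r *\<^sub>R (A + B ** K)) *v x) \<bullet> (P *v ((sqrt r *\<^sub>R (A + B ** K)) *v x))"
  using r by (simp add: bellman_def matrix_vector_mult_add_rdistrib scaleR_matrix_vector_assoc[symmetric]
      matrix_vector_mul_assoc[symmetric] matrix_vector_mult_scaleR flip: mult.assoc)

text \<open>The Riccati equation is a Lyapunov equation for the closed loop. An eigenvector for an
  eigenvalue of modulus at least 1 would incur no stage cost; there the closed loop agrees with
  \<open>sqrt r\<close> times \<open>A + G ** psd_sqrt Q\<close>, which detectability makes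
  stable.\<close>

lemma closed_loop_stable:
  assumes "ric P"
  shows "schur_stable (sqrt r *\<^sub>R (A + B ** L P))"
  unfolding schur_stable_def
proof (intro allI impI)
  let ?T = "sqrt r *\<^sub>R (A + B ** L P)" and ?L = "L P" and ?C = "psd_sqrt Q"
  fix z :: complex and v :: "complex^'n"
  assume "v \<noteq> 0 \<and> (\<chi> i j. complex_of_real (?T $ i $ j)) *v v = z *s v"
  then have v: "v \<noteq> 0" "(\<chi> i j. complex_of_real (?T $ i $ j)) *v v = z *s v" by auto
  define a b where "a = (\<chi> i. Re (v $ i))" and "b = (\<chi> i. Im (v $ i))"
  have T: "?T *v a = Re z *\<^sub>R a - Im z *\<^sub>R b" "?T *v b = Im z *\<^sub>R a + Re z *\<^sub>R b"
    using v(2) unfolding complexification_eigen_iff a_def b_def by auto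
  define q where "q x = x \<bullet> (P *v x)" for x
  define w where "w x = x \<bullet> (Q *v x) + (?L *v x) \<bullet> (R *v (?L *v x))" for x
  have P: "psd P" "transpose P = P" and q0: "\<And>x. 0 \<le> q x" using assms by (auto simp: psd_def q_def)
  have lyap: "q x = w x + q (?T *v x)" for x
    unfolding q_def w_def
    using bell_ge_schur(2)[OF P(1), of x] unfolding ric_schur[OF assms] bell_gain by simp
  have rot: "q (?T *v a) + q (?T *v b) = (cmod z)\<^sup>2 * (q a + q b)"
    unfolding T q_def form_rotation[OF P(2)] by (simp add: cmod_power2)
  show "cmod z < 1"
  proof (rule ccontr)
    assume "\<not> cmod z < 1"
    then have z1: "1 \<le> cmod z" by simp
    then have "1 \<le> (cmod z)\<^sup>2" by simp
    then have "q a + q b \<le> (cmod z)\<^sup>2 * (q a + q b)"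
      using q0[of a] q0[of b] by (intro mult_le_cancel_right1[THEN iffD2]) auto
    \<comment> \<open>By \<open>lyap\<close> and \<open>rot\<close> the stage costs of
      \<open>a\<close> and \<open>b\<close> sum to \<open>q a + q b\<close> minus
      \<open>(cmod z)\<^sup>2\<close> times that same sum.\<close>
    then have "w a + w b \<le> 0" using lyap[of a] lyap[of b] rot by linarith
    then have w0: "x \<bullet> (Q *v x) = 0 \<and> (?L *v x) \<bullet> (R *v (?L *v x)) = 0" if "x \<in> {a, b}" for x
      using that form_nonneg(1)[of a] form_nonneg(1)[of b] form_nonneg(2)[of "?L *v a"] form_nonneg(2)[of "?L *v b"]
      unfolding w_def by auto
    obtain G where G: "schur_stable (A + G ** ?C)" using detectable by (auto simp: detectable_def)
    \<comment> \<open>On \<open>a\<close> and \<open>b\<close> both the feedback and the output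
      injection vanish, so either closed loop acts there as \<open>A\<close>, up to the factor
      \<open>sqrt r\<close>.\<close>
    have same: "(A + G ** ?C) *v x = (1 / sqrt r) *\<^sub>R (?T *v x)" if "x \<in> {a, b}" for x
    proof -
      have "?L *v x = 0" using w0[OF that] R unfolding pd_def by (metis less_irrefl)
      moreover have "?C *v x = 0" using w0[OF that] psd_sqrt_inner[OF Q, of x] by simp
      ultimately show ?thesis
        using r by (simp add: matrix_vector_mult_add_rdistrib matrix_vector_mul_assoc[symmetric]
            scaleR_matrix_vector_assoc[symmetric])
    qed
    let ?z = "complex_of_real (1 / sqrt r) * z"
    have "(\<chi> i j. complex_of_real ((A + G ** ?C) $ i $ j)) *v v = ?z *s v"
      using same[of a, OF insertI1] same[of b, OF insertI2[OF singletonI]]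
      unfolding complexification_eigen_iff a_def[symmetric] b_def[symmetric] T
      by (simp only:) (simp add: scaleR_diff_right scaleR_add_right)
    with G v(1) have "cmod ?z < 1" unfolding schur_stable_def by blast
    then have "cmod z < sqrt r" using r by (simp add: norm_mult norm_divide field_simps)
    also have "sqrt r < 1" using r by simp
    finally show False using z1 by simp
  qed
qed

text \<open>Comparison principle behind both uniqueness and optimality: along the closed loop of
  \<open>P\<close> the form of \<open>P - S\<close> does not increase, and it tends to 0, so it
  starts nonnegative.\<close>

lemma le_ric_solution:
  assumes P: "ric P" and S: "transpose S = S"
    and sub: "\<And>x. x \<bullet> (S *v x) \<le> bell S x (L P *v x)"
  shows "psd (P - S)"
proof -
  let ?T = "sqrt r *\<^sub>R (A + B ** L P)" and ?D = "P - S"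
  have tD: "transpose ?D = ?D" using P S by (simp add: transpose_matrix_diff psd_def)
  define d where "d x = x \<bullet> (?D *v x)" for x
  have d: "d x = x \<bullet> (P *v x) - x \<bullet> (S *v x)" for x
    by (simp add: d_def matrix_vector_mult_diff_rdistrib inner_diff_right)
  have step: "d (?T *v x) \<le> d x" for x
    using bell_ge_schur(2)[OF P[THEN conjunct1], of x] sub[of x]
    unfolding ric_schur[OF P] bell_gain d by linarith
  have iter: "d (((*v) ?T ^^ k) x) \<le> d x" for k x
  proof (induction k)
    case (Suc k)
    then show ?case using step[of "((*v) ?T ^^ k) x"] by simp
  qed simp
  have "0 \<le> d x" for x
  proof (rule LIMSEQ_le_const2)
    show "(\<lambda>k. d (((*v) ?T ^^ k) x)) \<longlonglongrightarrow> 0"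
      unfolding d_def by (rule stable_form_tendsto_0[OF closed_loop_stable[OF P]])
  qed (use iter in blast)
  with tD show ?thesis by (simp add: psd_def d_def)
qed

lemma ric_unique:
  assumes "ric P" "ric S"
  shows "P = S"
proof -
  have le: "psd (P - S)" if "ric P" "ric S" for P S
  proof (rule le_ric_solution[OF that(1)])
    show "transpose S = S" using that(2) by (simp add: psd_def)
    show "x \<bullet> (S *v x) \<le> bell S x (L P *v x)" for x
      using bell_ge_schur(1)[OF conjunct1[OF that(2)]] unfolding ric_schur[OF that(2)] .
  qed
  have "transpose S = S" using assms(2) by (simp add: psd_def)
  with le[OF assms] le[OF assms(2,1)] show ?thesis by (rule psd_antisym)
qed

section \<open>Existence of a Riccati solution\<close>

definition subsolutions :: "(real^'n^'n) set" where
  "subsolutions = {S. psd S \<and> (\<forall>x u. x \<bullet> (S *v x) \<le> bell S x u)}"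

text \<open>A subsolution lies below the cost of any fixed feedback. For a stabilizing
  \<open>K\<close> the stage costs are uniformly bounded along the orbit, and discounting makes
  their sum finite.\<close>

lemma subsolutions_bounded: "bounded subsolutions"
proof -
  obtain K where K: "schur_stable (A + B ** K)" using stabilizable by (auto simp: stabilizable_def)
  let ?M = "A + B ** K"
  let ?pow = "\<lambda>k x. ((*v) ?M ^^ k) x"
  obtain C where C: "0 \<le> C" "\<And>k x. norm (?pow k x) \<le> C * norm x"
    using stable_powers_bounded[of "(*v) ?M"] schur_stable_powers_tendsto_0[OF K] by auto
  let ?W = "Q + transpose K ** R ** K"
  obtain c where c: "0 \<le> c" "\<And>x. x \<bullet> (?W *v x) \<le> c * (norm x)\<^sup>2"
    by (rule quadratic_form_bound[of ?W]) blast
  define D where "D = c * C\<^sup>2"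
  have bound: "norm S \<le> real CARD('n) * (real CARD('n) * (D / (1 - r)))" if "S \<in> subsolutions" for S
  proof (rule psd_norm_le)
    show "psd S" using that by (simp add: subsolutions_def)
    fix x :: "real^'n"
    define q where "q y = y \<bullet> (S *v y)" for y
    have q: "q y \<le> y \<bullet> (?W *v y) + r * q (?M *v y)" for y
    proof -
      have "y \<bullet> (?W *v y) = y \<bullet> (Q *v y) + (K *v y) \<bullet> (R *v (K *v y))"
        by (simp add: matrix_vector_mult_add_rdistrib inner_add_right congruence_inner)
      moreover have "?M *v y = A *v y + B *v (K *v y)"
        by (simp add: matrix_vector_mult_add_rdistrib matrix_vector_mul_assoc)
      ultimately show ?thesis
        using that unfolding subsolutions_def bellman_def q_def by auto
    qed
    \<comment> \<open>The geometric series of the stage cost bound, equivalently the fixed point of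
      the map sending t to \<open>D * (norm x)\<^sup>2 + r * t\<close>.\<close>
    define e where "e = D * (norm x)\<^sup>2 / (1 - r)"
    have e: "D * (norm x)\<^sup>2 + r * e = e" using r by (simp add: e_def field_simps)
    have Wpow: "?pow k x \<bullet> (?W *v ?pow k x) \<le> D * (norm x)\<^sup>2" for k
    proof -
      have "?pow k x \<bullet> (?W *v ?pow k x) \<le> c * (norm (?pow k x))\<^sup>2" by (rule c)
      also have "\<dots> \<le> c * (C * norm x)\<^sup>2" by (intro mult_left_mono power_mono C c) auto
      finally show ?thesis by (simp add: D_def power_mult_distrib)
    qed
    have iter: "q x - e \<le> r ^ k * (q (?pow k x) - e)" for k
    proof (induction k)
      case (Suc k)
      have "q (?pow k x) - e \<le> r * (q (?pow (Suc k) x) - e)"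
        using q[of "?pow k x"] Wpow[of k] e by (simp add: algebra_simps)
      then have "r ^ k * (q (?pow k x) - e) \<le> r ^ k * (r * (q (?pow (Suc k) x) - e))"
        using r by (intro mult_left_mono) auto
      with Suc show ?case by (simp add: mult_ac)
    qed simp
    have "(\<lambda>k. q (?pow k x)) \<longlonglongrightarrow> 0"
      unfolding q_def by (rule stable_form_tendsto_0[OF K])
    moreover have "(\<lambda>k. r ^ k) \<longlonglongrightarrow> 0" using r by (intro LIMSEQ_power_zero) simp
    ultimately have "(\<lambda>k. r ^ k * (q (?pow k x) - e)) \<longlonglongrightarrow> 0 * (0 - e)"
      by (intro tendsto_mult tendsto_diff tendsto_const)
    then have "(\<lambda>k. r ^ k * (q (?pow k x) - e)) \<longlonglongrightarrow> 0" by simp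
    then have "q x - e \<le> 0" by (rule LIMSEQ_le_const) (use iter in blast)
    then show "x \<bullet> (S *v x) \<le> D / (1 - r) * (norm x)\<^sup>2" by (simp add: q_def e_def)
  qed
  then show ?thesis by (auto simp: bounded_iff)
qed

text \<open>For fixed x and u, both sides of the defining inequality are affine in \<open>S\<close>
  and free of inverses, so the set is an intersection of closed conditions.\<close>

lemma subsolutions_compact: "compact subsolutions"
proof -
  have cont[continuous_intros]: "continuous_on UNIV (\<lambda>S::real^'n^'n. S *v x)" for x
    by (rule linear_continuous_on, rule linear_linear[THEN iffD2], rule linearI)
      (auto simp: matrix_vector_mult_add_rdistrib scaleR_matrix_vector_assoc)
  have "continuous_on UNIV (\<lambda>S::real^'n^'n. transpose S)"
    by (rule linear_continuous_on, rule linear_linear[THEN iffD2], rule linearI)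
      (auto simp: transpose_matrix_add transpose_scalar)
  then have "closed {S::real^'n^'n. transpose S = S}"
    by (intro closed_Collect_eq continuous_intros)
  moreover have "closed {S::real^'n^'n. \<forall>x. 0 \<le> x \<bullet> (S *v x)}"
    by (intro closed_Collect_all closed_Collect_le continuous_intros)
  moreover have "closed {S. \<forall>x u. x \<bullet> (S *v x) \<le> bell S x u}"
    unfolding bellman_def by (intro closed_Collect_all closed_Collect_le continuous_intros)
  ultimately have "closed ({S. transpose S = S} \<inter> {S. \<forall>x. 0 \<le> x \<bullet> (S *v x)}
      \<inter> {S. \<forall>x u. x \<bullet> (S *v x) \<le> bell S x u})"
    by (intro closed_Int)
  moreover have "subsolutions = {S. transpose S = S} \<inter> {S. \<forall>x. 0 \<le> x \<bullet> (S *v x)}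
      \<inter> {S. \<forall>x u. x \<bullet> (S *v x) \<le> bell S x u}"
    by (auto simp: subsolutions_def psd_def)
  ultimately show ?thesis using subsolutions_bounded by (simp add: compact_eq_bounded_closed)
qed

text \<open>A subsolution of maximal trace is a fixed point, because the Riccati operator maps
  subsolutions to larger subsolutions. This avoids continuity of the matrix inverse.\<close>
lemma ric_exists: "\<exists>P. ric P"
proof -
  have "0 \<in> subsolutions"
    by (auto simp: subsolutions_def psd_def bellman_def transpose_def vec_eq_iff form_nonneg)
  moreover have "continuous_on subsolutions (\<lambda>S. trace S)"
    unfolding trace_def by (intro continuous_intros)
  ultimately obtain S where S: "S \<in> subsolutions" and max: "\<And>T. T \<in> subsolutions \<Longrightarrow> trace T \<le> trace S"
    using continuous_attains_sup[OF subsolutions_compact, of trace] by blast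
  then have psdS: "psd S" and sub: "\<And>x u. x \<bullet> (S *v x) \<le> bell S x u" by (auto simp: subsolutions_def)
  let ?T = "schur_complement (H S)"
  have tS: "transpose S = S" using psdS by (simp add: psd_def)
  have tT: "transpose ?T = ?T"
    using r by (intro transpose_schur_complement transpose_q_matrix pd_block22_q_matrix sym R psdS tS) simp
  have le: "x \<bullet> (S *v x) \<le> x \<bullet> (?T *v x)" for x
    using sub[of x "L S *v x"] bell_ge_schur(2)[OF psdS, of x] by simp
  have "psd ?T"
    using tT psdS by (auto simp: psd_def intro: order_trans[OF _ le])
  \<comment> \<open>\<open>?T\<close> is the minimum of \<open>bell S\<close> over inputs, and
    \<open>bell\<close> is monotone in its matrix argument.\<close>
  moreover have "x \<bullet> (?T *v x) \<le> bell ?T x u" for x u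
    using bell_ge_schur(1)[OF psdS, of x u] bellman_mono[of r S ?T A B Q R x u] le r by force
  ultimately have "?T \<in> subsolutions" by (simp add: subsolutions_def)
  then have "trace (mat 1 ** (?T - S)) \<le> 0" using max by (simp add: trace_sub)
  moreover have "psd (?T - S)"
    using tT tS le by (simp add: psd_def transpose_matrix_diff matrix_vector_mult_diff_rdistrib inner_diff_right)
  moreover have "pd (mat 1 :: real^'n^'n)" by (simp add: pd_def transpose_mat)
  ultimately have "?T - S = 0" using trace_mult_pd_eq_0 by blast
  then have "riccati_solution r A B Q R S"
    by (simp add: riccati_solution_iff_schur_complement[OF tS])
  with psdS show ?thesis by blast
qed

subsection \<open>Optimal points of the semidefinite program\<close>

text \<open>Dropping the nonnegative square from the form of \<open>F\<close> leaves the Bellman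
  inequality for its Schur complement, to which the comparison principle applies.\<close>

lemma feasible_le_ric:
  assumes P: "ric P" and F: "feasible r A B Q R (F, M)"
  shows "psd (P - schur_complement F)" "psd (P - M)"
proof -
  let ?S = "schur_complement F"
  have F': "transpose F = F" "pd (block22 F)" "psd (?S - M)"
    "\<And>x u. stack x u \<bullet> (F *v stack x u) \<le> bell ?S x u"
    using F by (auto simp: feasible_iff_bellman[OF sym])
  have "x \<bullet> (?S *v x) \<le> bell ?S x (L P *v x)" for x
    using F'(4)[of x "L P *v x"] psd_if_pd[OF F'(2)] unfolding complete_square[OF F'(1,2)] psd_def
    by (smt (verit))
  then show 1: "psd (P - ?S)"
    by (intro le_ric_solution P transpose_schur_complement F')
  have "P - M = (P - ?S) + (?S - M)" by simp
  then show "psd (P - M)" using 1 F'(3) by (metis psd_add)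
qed

text \<open>At \<open>H P\<close> the Bellman inequality is an equality, since the Schur complement
  is again \<open>P\<close>; the upper bound \<open>P\<close> on \<open>M\<close> is thus
  attained.\<close>

lemma feasible_q_matrix:
  assumes "ric P"
  shows "feasible r A B Q R (H P, P)"
proof -
  have P: "psd P" "transpose P = P" using assms by (auto simp: psd_def)
  have "psd (0 :: real^'n^'n)" by (simp add: psd_def) (simp add: transpose_def vec_eq_iff)
  then show ?thesis
    using r unfolding feasible_iff_bellman[OF sym]
    by (simp add: transpose_q_matrix sym P pd_block22_q_matrix R ric_schur[OF assms] q_matrix_form)
qed

text \<open>\<open>P\<close> is the greatest feasible \<open>M\<close> in the Loewner order, and a
  positive definite weight is strictly monotone for that order. \<open>V\<close> is absent from the
  right-hand side, which yields independence of the weight.\<close>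

lemma optimal_points_eq:
  assumes P: "ric P" and V: "pd V"
  shows "optimal_points r A B Q R V = {(F, M). feasible r A B Q R (F, M) \<and> M = P}"
proof -
  have le: "trace (V ** M) \<le> trace (V ** P)" if "feasible r A B Q R (F, M)"
    for F :: "real^('n + 'm)^('n + 'm)" and M
    using trace_mult_psd_nonneg[OF psd_if_pd[OF V] feasible_le_ric(2)[OF P that]]
    by (simp add: matrix_diff_ldistrib trace_sub)
  have "M = P" if "feasible r A B Q R (F, M)" "trace (V ** P) \<le> trace (V ** M)"
    for F :: "real^('n + 'm)^('n + 'm)" and M
    using trace_mult_pd_eq_0[OF V feasible_le_ric(2)[OF P that(1)]] that(2)
    by (simp add: matrix_diff_ldistrib trace_sub)
  then show ?thesis
    unfolding optimal_points_def using le feasible_q_matrix[OF P] by blast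
qed

text \<open>With \<open>M = P\<close> the Schur complement is squeezed to \<open>P\<close>, and the
  Bellman inequality says that the form of \<open>F\<close> lies below that of \<open>H P\<close>.
  At the input \<open>L P *v x\<close> both sides of it share the value of the form of
  \<open>P\<close>, up to the square that measures the difference of the gains, so this square
  vanishes.\<close>

lemma feasible_at_ric:
  assumes P: "ric P" and F: "feasible r A B Q R (F, P)"
  shows "psd (H P - F)" "gain F = L P"
proof -
  have psdP: "psd P" "transpose P = P" using P by (auto simp: psd_def)
  have F': "transpose F = F" "pd (block22 F)" "psd (schur_complement F - P)"
    "\<And>x u. stack x u \<bullet> (F *v stack x u) \<le> bell (schur_complement F) x u"
    using F by (auto simp: feasible_iff_bellman[OF sym])
  have S: "schur_complement F = P"
    by (rule psd_antisym[OF F'(3) feasible_le_ric(1)[OF P F] psdP(2)])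
  have form: "stack x u \<bullet> (F *v stack x u) \<le> stack x u \<bullet> (H P *v stack x u)" for x u
    using F'(4)[of x u] by (simp add: S q_matrix_form psdP)
  have "0 \<le> y \<bullet> ((H P - F) *v y)" for y
  proof -
    obtain x u where "y = stack x u" by (rule stack_exhaust)
    then show ?thesis using form[of x u] by (simp add: matrix_vector_mult_diff_rdistrib inner_diff_right)
  qed
  then show "psd (H P - F)"
    by (simp add: psd_def transpose_matrix_diff transpose_q_matrix sym psdP F')
  have "gain F *v x = L P *v x" for x
  proof -
    let ?d = "L P *v x - gain F *v x"
    have "x \<bullet> (P *v x) + ?d \<bullet> (block22 F *v ?d) \<le> x \<bullet> (P *v x)"
      using F'(4)[of x "L P *v x"] bell_ge_schur(2)[OF psdP(1), of x]
      unfolding complete_square[OF F'(1,2)] S ric_schur[OF P] by simp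
    then have "?d = 0" using F'(2) unfolding pd_def by (smt (verit))
    then show ?thesis by simp
  qed
  then show "gain F = L P" by (simp add: matrix_eq)
qed

end

text \<open>Optimal points determine \<open>M\<close> but not \<open>F\<close>. Accordingly, the
  identity of F with the Q-function matrix is expressed by that matrix being the greatest optimal
  \<open>F\<close> in the Loewner order, with one gain common to all optimal \<open>F\<close>;
  independence of the weight is equality of the sets of optimal points.\<close>

theorem theorem2:
  fixes A :: "real^'n^'n" and B :: "real^'m^'n"
    and Q :: "real^'n^'n" and R :: "real^'m^'m"
    and \<mu>0 :: "real^'n" and \<Sigma>0 \<Sigma> :: "real^'n^'n"
  assumes "psd Q" and "pd R"
    and "stabilizable A B" and "detectable A (psd_sqrt Q)"
    and "pd \<Sigma>0" and "psd \<Sigma>"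
  shows "\<exists>r0<1. \<forall>r. 0 < r \<and> r0 < r \<and> r < 1 \<longrightarrow>
    (\<exists>Ps.
       (\<forall>P. psd P \<and> riccati_solution r A B Q R P \<longleftrightarrow> P = Ps) \<and>
       (q_matrix r A B Q R Ps, Ps) \<in> optimal_points r A B Q R (second_moment r \<mu>0 \<Sigma>0 \<Sigma>) \<and>
       (\<forall>F M. (F, M) \<in> optimal_points r A B Q R (second_moment r \<mu>0 \<Sigma>0 \<Sigma>) \<longrightarrow>
          M = Ps \<and>
          psd (q_matrix r A B Q R Ps - F) \<and>
          - (matrix_inv (block22 F) ** transpose (block12 F)) = optimal_gain r A B R Ps) \<and>
       (\<forall>\<mu>0' \<Sigma>0' \<Sigma>'. pd \<Sigma>0' \<and> psd \<Sigma>' \<longrightarrow>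
          optimal_points r A B Q R (second_moment r \<mu>0' \<Sigma>0' \<Sigma>') =
          optimal_points r A B Q R (second_moment r \<mu>0 \<Sigma>0 \<Sigma>)))"
\<comment> \<open>The threshold is 0, because the locale \<open>lqr\<close> asks for a discount
  factor strictly between 0 and 1.\<close>
proof (rule exI[of _ 0], intro conjI allI impI)
  show "(0::real) < 1" by simp
  fix r :: real
  assume r: "0 < r \<and> 0 < r \<and> r < 1"
  then interpret lqr r A B Q R using assms by unfold_locales auto
  obtain Ps where Ps: "ric Ps" using ric_exists by blast
  have opt: "optimal_points r A B Q R (second_moment r \<mu> S0 S) =
      {(F, M). feasible r A B Q R (F, M) \<and> M = Ps}" if "pd S0" "psd S" for \<mu> S0 S
    using r that by (intro optimal_points_eq Ps pd_second_moment) auto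
  show "\<exists>Ps.
       (\<forall>P. psd P \<and> riccati_solution r A B Q R P \<longleftrightarrow> P = Ps) \<and>
       (q_matrix r A B Q R Ps, Ps) \<in> optimal_points r A B Q R (second_moment r \<mu>0 \<Sigma>0 \<Sigma>) \<and>
       (\<forall>F M. (F, M) \<in> optimal_points r A B Q R (second_moment r \<mu>0 \<Sigma>0 \<Sigma>) \<longrightarrow>
          M = Ps \<and>
          psd (q_matrix r A B Q R Ps - F) \<and>
          - (matrix_inv (block22 F) ** transpose (block12 F)) = optimal_gain r A B R Ps) \<and>
       (\<forall>\<mu>0' \<Sigma>0' \<Sigma>'. pd \<Sigma>0' \<and> psd \<Sigma>' \<longrightarrow>
          optimal_points r A B Q R (second_moment r \<mu>0' \<Sigma>0' \<Sigma>') =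
          optimal_points r A B Q R (second_moment r \<mu>0 \<Sigma>0 \<Sigma>))"
  proof (intro exI[of _ Ps] conjI)
    show "\<forall>P. psd P \<and> riccati_solution r A B Q R P \<longleftrightarrow> P = Ps"
      using Ps ric_unique by blast
    show "(q_matrix r A B Q R Ps, Ps) \<in> optimal_points r A B Q R (second_moment r \<mu>0 \<Sigma>0 \<Sigma>)"
      using feasible_q_matrix[OF Ps] by (simp add: opt assms)
    show "\<forall>F M. (F, M) \<in> optimal_points r A B Q R (second_moment r \<mu>0 \<Sigma>0 \<Sigma>) \<longrightarrow>
          M = Ps \<and>
          psd (q_matrix r A B Q R Ps - F) \<and>
          - (matrix_inv (block22 F) ** transpose (block12 F)) = optimal_gain r A B R Ps"
      using feasible_at_ric[OF Ps] by (auto simp: opt assms gain_def)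
    show "\<forall>\<mu>0' \<Sigma>0' \<Sigma>'. pd \<Sigma>0' \<and> psd \<Sigma>' \<longrightarrow>
          optimal_points r A B Q R (second_moment r \<mu>0' \<Sigma>0' \<Sigma>') =
          optimal_points r A B Q R (second_moment r \<mu>0 \<Sigma>0 \<Sigma>)"
      by (simp add: opt assms)
  qed
qed

end
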